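(* Let $\lambda$ be a partition of $n$. If $n$ is odd, then $\mathrm{alt}(\lambda)=\mathrm{ralt}(\lambda)=s_\lambda[E,0,-E,0,E,0,-E,\dots]$. If $n$ is even, then $\mathrm{alt}(\lambda)=s_\lambda[E,-1,-E,1,E,-1,-E,1,\dots]$ and $\mathrm{ralt}(\lambda)=s_\lambda[E,1,-E,-1,E,1,-E,-1,\dots]$, evaluated umbrally.
   Context: For a standard Young tableau (SYT) $T$ with $n$ entries, its descent set is $D(T)=\{i: i+1 \text{ appears in a lower row than } i\}$. $T$ is alternating if $D(T)=\{1,3,5,\dots\}\cap[n-1]$ and reverse alternating if $D(T)=\{2,4,6,\dots\}\cap[n-1]$. $\mathrm{alt}(\lambda)$ and $\mathrm{ralt}(\lambda)$ denote the numbers of alternating and reverse alternating SYT of shape $\lambda$. $s_\lambda$ is the Schur function. Euler numbers $E_n$: $\sum_{n\ge0}E_nx^n/n!=\sec x+\tan x$. Substitution notation: $f[a_1,a_2,\dots]$ means write the symmetric function $f$ as a polynomial in the power sums $p_1,p_2,\dots$ and set $p_i=a_i$; $[E,0,-E,0,\dots]$ means $p_{2j+1}=(-1)^jE$, $p_{2j}=0$; $[E,-1,-E,1,\dots]$ means $p_{2j+1}=(-1)^jE$, $p_{2j}=(-1)^j$; $[E,1,-E,-1,\dots]$ means $p_{2j+1}=(-1)^jE$, $p_{2j}=(-1)^{j+1}$. Umbral evaluation: expand the resulting polynomial in the indeterminate $E$ in powers of $E$ and then, as the last step, replace each $E^k$ by $E_k$. *)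

theory Defs
  imports
    "HOL-Library.Poly_Mapping"
    "HOL-Library.FuncSet"
    "HOL-Computational_Algebra.Computational_Algebra"
begin

section \<open>Formal power series in infinitely many variables\<close>

text \<open>
  Power series in \<open>x\<^sub>0, x\<^sub>1, \<dots>\<close>, given by their coefficient functions. The monomial with
  exponent vector \<open>m :: nat \<Rightarrow>\<^sub>0 nat\<close> is \<open>\<Prod>i. x\<^sub>i ^ lookup m i\<close>.
\<close>

typedef 'a mfps = "UNIV :: ((nat \<Rightarrow>\<^sub>0 nat) \<Rightarrow> 'a) set"
  morphisms mfps_coeff Mfps ..

setup_lifting type_definition_mfps

lemma mfps_coeff_Mfps [simp]: "mfps_coeff (Mfps f) m = f m"
  by (simp add: Mfps_inverse)

lemma mfps_eqI: "(\<And>m. mfps_coeff f m = mfps_coeff g m) \<Longrightarrow> f = g"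
  by transfer auto

definition mon_splits :: "(nat \<Rightarrow>\<^sub>0 nat) \<Rightarrow> ((nat \<Rightarrow>\<^sub>0 nat) \<times> (nat \<Rightarrow>\<^sub>0 nat)) set" where
  "mon_splits m = {(a, b). a + b = m}"

lemma finite_mon_splits [simp]: "finite (mon_splits m)"
proof -
  define S where "S = {f :: nat \<Rightarrow> nat. \<forall>x.
    (x \<in> Poly_Mapping.keys m \<longrightarrow>
       f x \<in> {..Max (insert 0 (Poly_Mapping.lookup m ` Poly_Mapping.keys m))}) \<and>
    (x \<notin> Poly_Mapping.keys m \<longrightarrow> f x = 0)}"
  have finS: "finite S"
    unfolding S_def by (rule finite_set_of_finite_funs) auto
  have in_S: "Poly_Mapping.lookup a \<in> S"
    if le: "\<And>x. Poly_Mapping.lookup a x \<le> Poly_Mapping.lookup m x" for a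
  proof -
    have "Poly_Mapping.lookup a x \<le> Max (insert 0 (Poly_Mapping.lookup m ` Poly_Mapping.keys m))"
      if "x \<in> Poly_Mapping.keys m" for x
      using that le[of x] by (intro order_trans[OF le[of x]] Max_ge) auto
    moreover have "Poly_Mapping.lookup a x = 0" if "x \<notin> Poly_Mapping.keys m" for x
      using that le[of x] by (simp add: in_keys_iff)
    ultimately show ?thesis by (auto simp: S_def)
  qed
  have "finite {a :: nat \<Rightarrow>\<^sub>0 nat. Poly_Mapping.lookup a \<in> S}"
    using finite_vimageI[OF finS, of Poly_Mapping.lookup] by (simp add: vimage_def inj_def lookup_inject)
  moreover have "mon_splits m \<subseteq> {a. Poly_Mapping.lookup a \<in> S} \<times> {a. Poly_Mapping.lookup a \<in> S}"
    by (auto simp: mon_splits_def lookup_add intro!: in_S)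
  ultimately show ?thesis
    by (meson finite_SigmaI finite_subset)
qed

instantiation mfps :: (comm_ring_1) comm_ring_1
begin

lift_definition zero_mfps :: "'a mfps" is "\<lambda>_. 0" .
lift_definition one_mfps :: "'a mfps" is "\<lambda>m. if m = 0 then 1 else 0" .
lift_definition plus_mfps :: "'a mfps \<Rightarrow> 'a mfps \<Rightarrow> 'a mfps" is "\<lambda>f g m. f m + g m" .
lift_definition minus_mfps :: "'a mfps \<Rightarrow> 'a mfps \<Rightarrow> 'a mfps" is "\<lambda>f g m. f m - g m" .
lift_definition uminus_mfps :: "'a mfps \<Rightarrow> 'a mfps" is "\<lambda>f m. - f m" .
lift_definition times_mfps :: "'a mfps \<Rightarrow> 'a mfps \<Rightarrow> 'a mfps" is
  "\<lambda>f g m. \<Sum>(a, b)\<in>mon_splits m. f a * g b" .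

instance
proof
  fix f g h :: "'a mfps"
  show "f * g * h = f * (g * h)"
  proof (transfer, rule ext)
    fix f g h :: "(nat \<Rightarrow>\<^sub>0 nat) \<Rightarrow> 'a" and m
    have "(\<Sum>(d, c)\<in>mon_splits m. (\<Sum>(a, b)\<in>mon_splits d. f a * g b) * h c)
        = (\<Sum>((d, c), (a, b))\<in>Sigma (mon_splits m) (\<lambda>(d, c). mon_splits d). f a * g b * h c)"
      by (subst sum.Sigma[symmetric]) (auto simp: sum_distrib_right case_prod_beta)
    also have "\<dots> = (\<Sum>((a, e), (b, c))\<in>Sigma (mon_splits m) (\<lambda>(a, e). mon_splits e). f a * (g b * h c))"
      by (rule sum.reindex_bij_witness[of _ "\<lambda>((a, e), (b, c)). ((a + b, c), (a, b))"
            "\<lambda>((d, c), (a, b)). ((a, b + c), (b, c))"])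
         (auto simp: mon_splits_def algebra_simps)
    also have "\<dots> = (\<Sum>(a, e)\<in>mon_splits m. f a * (\<Sum>(b, c)\<in>mon_splits e. g b * h c))"
      by (subst sum.Sigma[symmetric]) (auto simp: sum_distrib_left case_prod_beta)
    finally show "(\<Sum>(d, c)\<in>mon_splits m. (\<Sum>(a, b)\<in>mon_splits d. f a * g b) * h c)
        = (\<Sum>(a, e)\<in>mon_splits m. f a * (\<Sum>(b, c)\<in>mon_splits e. g b * h c))" .
  qed
  show "f * g = g * f"
  proof (transfer, rule ext)
    fix f g :: "(nat \<Rightarrow>\<^sub>0 nat) \<Rightarrow> 'a" and m
    show "(\<Sum>(a, b)\<in>mon_splits m. f a * g b) = (\<Sum>(a, b)\<in>mon_splits m. g a * f b)"
      by (rule sum.reindex_bij_witness[of _ prod.swap prod.swap])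
         (auto simp: mon_splits_def algebra_simps)
  qed
  show "1 * f = f"
  proof (transfer, rule ext)
    fix f :: "(nat \<Rightarrow>\<^sub>0 nat) \<Rightarrow> 'a" and m
    have "(\<Sum>(a, b)\<in>mon_splits m. (if a = 0 then 1 else 0) * f b)
        = (\<Sum>(a, b)\<in>{(0 :: nat \<Rightarrow>\<^sub>0 nat, m)}. (if a = 0 then 1 else 0) * f b)"
      by (rule sum.mono_neutral_right, simp) (auto simp: mon_splits_def split: if_splits)
    then show "(\<Sum>(a, b)\<in>mon_splits m. (if a = 0 then 1 else 0) * f b) = f m"
      by simp
  qed
  show "(f + g) * h = f * h + g * h"
    by transfer (auto simp: fun_eq_iff case_prod_beta algebra_simps sum.distrib)
  show "f + g + h = f + (g + h)" "f + g = g + f" "0 + f = f" "- f + f = 0" "f - g = f + - g"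
    by (transfer; simp add: fun_eq_iff algebra_simps)+
  show "(0 :: 'a mfps) \<noteq> 1"
    by transfer (auto simp: fun_eq_iff)
qed

end

definition mfps_const :: "'a::comm_ring_1 \<Rightarrow> 'a mfps" where
  "mfps_const c = Mfps (\<lambda>m. if m = 0 then c else 0)"


section \<open>Young diagrams and tableaux\<close>

definition is_partition_of :: "nat list \<Rightarrow> nat \<Rightarrow> bool" where
  "is_partition_of lam n \<longleftrightarrow> sorted_wrt (\<ge>) lam \<and> 0 \<notin> set lam \<and> sum_list lam = n"

text \<open>
  A cell is a pair (row, column), counted from 0, with rows numbered from top to bottom.
  Tableaux are extensional functions on the cells, so that each filling is counted once.
\<close>

definition cells :: "nat list \<Rightarrow> (nat \<times> nat) set" where
  "cells lam = {(i, j). i < length lam \<and> j < lam ! i}"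

definition SSYT :: "nat list \<Rightarrow> (nat \<times> nat \<Rightarrow> nat) set" where
  "SSYT lam = {T \<in> extensional (cells lam).
     (\<forall>i j j'. j < j' \<and> (i, j') \<in> cells lam \<longrightarrow> T (i, j) \<le> T (i, j')) \<and>
     (\<forall>i i' j. i < i' \<and> (i', j) \<in> cells lam \<longrightarrow> T (i, j) < T (i', j))}"

definition SYT :: "nat list \<Rightarrow> (nat \<times> nat \<Rightarrow> nat) set" where
  "SYT lam = {T \<in> extensional (cells lam).
     bij_betw T (cells lam) {1..sum_list lam} \<and>
     (\<forall>i j j'. j < j' \<and> (i, j') \<in> cells lam \<longrightarrow> T (i, j) < T (i, j')) \<and>
     (\<forall>i i' j. i < i' \<and> (i', j) \<in> cells lam \<longrightarrow> T (i, j) < T (i', j))}"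

definition descent_set :: "nat list \<Rightarrow> (nat \<times> nat \<Rightarrow> nat) \<Rightarrow> nat set" where
  "descent_set lam T = {k. \<exists>i j i' j'. (i, j) \<in> cells lam \<and> (i', j') \<in> cells lam \<and>
     T (i, j) = k \<and> T (i', j') = k + 1 \<and> i < i'}"

definition alt :: "nat list \<Rightarrow> nat" where
  "alt lam = card {T \<in> SYT lam. descent_set lam T = {k. 1 \<le> k \<and> k < sum_list lam \<and> odd k}}"

definition ralt :: "nat list \<Rightarrow> nat" where
  "ralt lam = card {T \<in> SYT lam. descent_set lam T = {k. 1 \<le> k \<and> k < sum_list lam \<and> even k}}"


section \<open>Schur functions and substitution for power sums\<close>

text \<open>
  The Schur function is the generating function of semistandard tableaux by content. As the
  variables are \<open>x\<^sub>0, x\<^sub>1, \<dots>\<close>, semistandard tableaux have entries in \<open>{0, 1, \<dots>}\<close>.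
\<close>

definition schur :: "nat list \<Rightarrow> rat mfps" where
  "schur lam = Mfps (\<lambda>m. of_nat (card {T \<in> SSYT lam.
     \<forall>k. card {c \<in> cells lam. T c = k} = Poly_Mapping.lookup m k}))"

text \<open>The series \<open>\<Sum>i. x\<^sub>i ^ k\<close>; meaningful for \<open>k > 0\<close> only.\<close>

definition power_sum :: "nat \<Rightarrow> rat mfps" where
  "power_sum k = Mfps (\<lambda>m. if \<exists>i. m = Poly_Mapping.single i k then 1 else 0)"

text \<open>
  Evaluation of a polynomial in indeterminates indexed by \<open>nat\<close> at \<open>a\<close>, in a
  \<open>rat\<close>-algebra with structure map \<open>\<iota>\<close>.
\<close>

definition poly_subst ::
  "(rat \<Rightarrow> 'a::comm_ring_1) \<Rightarrow> (nat \<Rightarrow> 'a) \<Rightarrow> ((nat \<Rightarrow>\<^sub>0 nat) \<Rightarrow>\<^sub>0 rat) \<Rightarrow> 'a" where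
  "poly_subst \<iota> a q = (\<Sum>m\<in>Poly_Mapping.keys q. \<iota> (Poly_Mapping.lookup q m) *
     (\<Prod>i\<in>Poly_Mapping.keys m. a i ^ Poly_Mapping.lookup m i))"

text \<open>
  The indeterminate with index \<open>i\<close> stands for the power sum \<open>p\<^sub>i\<close>, so index 0 must not occur.
  The polynomial is unique because the power sums are algebraically independent.
\<close>

definition power_sum_expansion :: "rat mfps \<Rightarrow> ((nat \<Rightarrow>\<^sub>0 nat) \<Rightarrow>\<^sub>0 rat)" where
  "power_sum_expansion f =
     (SOME q. (\<forall>m\<in>Poly_Mapping.keys q. 0 \<notin> Poly_Mapping.keys m) \<and>
        f = poly_subst mfps_const power_sum q)"

definition sym_subst :: "rat mfps \<Rightarrow> (nat \<Rightarrow> rat poly) \<Rightarrow> rat poly" where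
  "sym_subst f a = poly_subst (\<lambda>c. [:c:]) a (power_sum_expansion f)"


section \<open>Euler numbers and umbral evaluation\<close>

definition euler_number :: "nat \<Rightarrow> rat" where
  "euler_number n = fact n * fps_nth (inverse (fps_cos 1) + fps_tan 1) n"

definition umbral :: "rat poly \<Rightarrow> rat" where
  "umbral P = (\<Sum>k\<le>degree P. coeff P k * euler_number k)"

text \<open>
  The three substitutions, with the indeterminate \<open>E\<close> being \<open>[:0, 1:]\<close>:
  \<open>[E, 0, -E, 0, \<dots>]\<close>, \<open>[E, -1, -E, 1, \<dots>]\<close> and \<open>[E, 1, -E, -1, \<dots>]\<close>. Entries are numbered from 1.
\<close>

definition subst_odd :: "nat \<Rightarrow> rat poly" where
  "subst_odd i = (if odd i then (-1) ^ (i div 2) * [:0, 1:] else 0)"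

definition subst_even_alt :: "nat \<Rightarrow> rat poly" where
  "subst_even_alt i = (if odd i then (-1) ^ (i div 2) * [:0, 1:] else (-1) ^ (i div 2))"

definition subst_even_ralt :: "nat \<Rightarrow> rat poly" where
  "subst_even_ralt i = (if odd i then (-1) ^ (i div 2) * [:0, 1:] else (-1) ^ (i div 2 + 1))"

end

theory Submission
  imports Defs
begin

text \<open>
  By standardization, the coefficient of \<open>x\<^sup>\<alpha>\<close> in the Schur function counts the standard tableaux
  whose descents are partial sums of the composition \<open>\<alpha>\<close>. Inclusion-exclusion therefore turns the
  number of (reverse) alternating tableaux into a linear functional of the Schur function: a signed
  sum of coefficients over compositions with prescribed parities. On a product of power sums
  \<open>p\<^sub>k\<close>, \<open>k\<close> ranging over a multiset \<open>B\<close>, splitting off the last part of the composition gives a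
  recursion over subsets of \<open>B\<close>, a convolution with \<open>Re i\<^sup>k\<close> or \<open>Im i\<^sup>k\<close> for \<open>k\<close> the sum of the subset.
  The recursion is solved by the coefficients of secant and tangent, because \<open>cos * sec = 1\<close>,
  \<open>sin * sec = tan\<close>, \<open>cos * tan = sin\<close> and \<open>cos + sin * tan = sec\<close>; these coefficients are the
  Euler numbers, indexed by the number of odd elements of \<open>B\<close>. Finally, the Schur function is a
  polynomial in power sums since it is symmetric (Bender-Knuth involution on Gelfand-Tsetlin
  patterns) and products of power sums are triangular in the monomial symmetric functions.
\<close>

text \<open>Consider functions of a finite set of parts of the form: sign, times u(number of even
  parts), times v(number of odd parts). Convolution over subsets multiplies the signs and convolves
  u and v separately. Because i^k is a sign, times i when k is odd, \<open>cosn\<close> and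
  \<open>sinn\<close> of a sum of parts have this form with u = 1. So the even parts enter the
  solutions only through what convolution makes of the constant 1: its inverse (-1)^e, the delta at
  e = 0, or 1 itself. These are u^e for u = -1, 0, 1, which is the origin of the three
  substitutions. The odd parts carry the secant or tangent number. Umbral evaluation mixes both
  kinds, but the number of odd parts has the parity of n, so only one kind survives.

  An obstacle lies in the expansion, which is an arbitrary choice of a polynomial in power sums,
  while the recursion is solved only for products of degree n. Hence it has to be shown that every
  polynomial in power sums representing a homogeneous series of degree n has only monomials of
  weight n.\<close>

section \<open>Coefficients of products of power sums\<close>

lemma mfps_coeff_zero [simp]: "mfps_coeff 0 m = 0"
  by (simp add: zero_mfps.rep_eq)

lemma mfps_coeff_one: "mfps_coeff 1 m = (if m = 0 then 1 else 0)"
  by (simp add: one_mfps.rep_eq)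

lemma mfps_coeff_add [simp]: "mfps_coeff (f + g) m = mfps_coeff f m + mfps_coeff g m"
  by (simp add: plus_mfps.rep_eq)

lemma mfps_coeff_diff [simp]: "mfps_coeff (f - g) m = mfps_coeff f m - mfps_coeff g m"
  by (simp add: minus_mfps.rep_eq)

lemma mfps_coeff_mult:
  "mfps_coeff (f * g) m = (\<Sum>(a, b)\<in>mon_splits m. mfps_coeff f a * mfps_coeff g b)"
  by (simp add: times_mfps.rep_eq)

lemma mfps_coeff_sum: "mfps_coeff (sum f A) m = (\<Sum>x\<in>A. mfps_coeff (f x) m)"
  by (induction A rule: infinite_finite_induct) auto

lemma mfps_coeff_const_mult [simp]: "mfps_coeff (mfps_const c * f) m = c * mfps_coeff f m"
proof -
  have "mfps_coeff (mfps_const c * f) m =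
      (\<Sum>(a, b)\<in>{(0 :: nat \<Rightarrow>\<^sub>0 nat, m)}. (if a = 0 then c else 0) * mfps_coeff f b)"
    unfolding mfps_coeff_mult mfps_const_def
    by (rule sum.mono_neutral_cong_right, simp) (auto simp: mon_splits_def split: if_splits)
  then show ?thesis by simp
qed

lemma single_eq_single_iff:
  "Poly_Mapping.single i k = Poly_Mapping.single j k \<longleftrightarrow> i = j" if "k \<noteq> 0"
  using that by (metis lookup_single_eq lookup_single_not_eq)

lemma lookup_sum_single:
  "finite B \<Longrightarrow> Poly_Mapping.lookup (\<Sum>b\<in>B. Poly_Mapping.single (f b) (k b)) r = sum k {b \<in> B. f b = r}"
  by (simp add: lookup_sum lookup_single when_def sum.If_cases Int_def)

text \<open>The term of the expanded product of the \<open>power_sum (k b)\<close> that arises when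
  the factor \<open>b\<close> contributes the variable with index \<open>f b\<close>.\<close>

definition monom_of :: "('b \<Rightarrow> nat) \<Rightarrow> 'b set \<Rightarrow> ('b \<Rightarrow> nat) \<Rightarrow> nat \<Rightarrow>\<^sub>0 nat" where
  "monom_of k B f = (\<Sum>b\<in>B. Poly_Mapping.single (f b) (k b))"

definition colourings :: "('b \<Rightarrow> nat) \<Rightarrow> 'b set \<Rightarrow> (nat \<Rightarrow>\<^sub>0 nat) \<Rightarrow> ('b \<Rightarrow> nat) set" where
  "colourings k B m = {f \<in> B \<rightarrow>\<^sub>E UNIV. monom_of k B f = m}"

lemma monom_of_cong: "(\<And>b. b \<in> B \<Longrightarrow> f b = g b) \<Longrightarrow> monom_of k B f = monom_of k B g"
  unfolding monom_of_def by (rule sum.cong) auto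

text \<open>For \<open>k > 0\<close> the index \<open>i\<close> can be read off from
  \<open>Poly_Mapping.single i k\<close>, so the pairs embed into \<open>mon_splits m\<close>; all
  other splittings meet a zero coefficient of the power sum.\<close>

lemma mfps_coeff_power_sum_mult:
  assumes "k > 0"
  shows "finite {(i, b). Poly_Mapping.single i k + b = m}"
    and "mfps_coeff (power_sum k * g) m =
      (\<Sum>(i, b)\<in>{(i, b). Poly_Mapping.single i k + b = m}. mfps_coeff g b)"
proof -
  let ?I = "{(i, b). Poly_Mapping.single i k + b = m}"
  let ?h = "\<lambda>(i, b). (Poly_Mapping.single i k, b)"
  have inj: "inj_on ?h ?I"
    using assms by (auto simp: inj_on_def single_eq_single_iff)
  have sub: "?h ` ?I \<subseteq> mon_splits m"
    by (auto simp: mon_splits_def)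
  show "finite ?I"
    using finite_imageD[OF finite_subset[OF sub finite_mon_splits] inj] .
  have "mfps_coeff (power_sum k * g) m = (\<Sum>(a, b)\<in>?h ` ?I. mfps_coeff g b)"
    unfolding mfps_coeff_mult power_sum_def
    by (rule sum.mono_neutral_cong_right[OF finite_mon_splits sub])
       (auto simp: mon_splits_def image_iff)
  also have "\<dots> = (\<Sum>(i, b)\<in>?I. mfps_coeff g b)"
    by (subst sum.reindex[OF inj]) (auto simp: case_prod_beta intro!: sum.cong)
  finally show "mfps_coeff (power_sum k * g) m = (\<Sum>(i, b)\<in>?I. mfps_coeff g b)" .
qed

text \<open>Expanding the product means choosing a variable in each factor. Finiteness is part of
  the induction because \<open>card\<close> of an infinite set is 0.\<close>

lemma mfps_coeff_prod_power_sum: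
  assumes "finite B" "\<And>b. b \<in> B \<Longrightarrow> k b > 0"
  shows "finite (colourings k B m) \<and>
    mfps_coeff (\<Prod>b\<in>B. power_sum (k b)) m = of_nat (card (colourings k B m))"
  using assms
proof (induction B arbitrary: m rule: finite_induct)
  case empty
  have "colourings k {} m = (if m = 0 then {\<lambda>_. undefined} else {})"
    by (auto simp: colourings_def monom_of_def)
  then show ?case by (simp add: mfps_coeff_one)
next
  case (insert x B)
  let ?I = "{(i, b). Poly_Mapping.single i (k x) + b = m}"
  let ?S = "Sigma ?I (\<lambda>(i, b). colourings k B b)"
  have IH: "finite (colourings k B m)"
    "mfps_coeff (\<Prod>b\<in>B. power_sum (k b)) m = of_nat (card (colourings k B m))" for m
    using insert by auto
  have kx: "k x > 0" using insert by auto
  have upd: "monom_of k B (g(x := i)) = monom_of k B g" for g i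
    using insert.hyps by (intro monom_of_cong) auto
  have res: "monom_of k B (restrict g B) = monom_of k B g" for g
    by (intro monom_of_cong) auto
  have ins: "monom_of k (insert x B) g = Poly_Mapping.single (g x) (k x) + monom_of k B g" for g
    using insert.hyps by (simp add: monom_of_def)
  have bij: "bij_betw (\<lambda>((i, b), g). g(x := i)) ?S (colourings k (insert x B) m)"
    by (rule bij_betw_byWitness[where f' = "\<lambda>f. ((f x, monom_of k B f), restrict f B)"])
       (use insert.hyps in \<open>auto simp: colourings_def upd res ins PiE_def extensional_def
          fun_eq_iff\<close>)
  have fin: "finite ?S"
    using mfps_coeff_power_sum_mult(1)[OF kx] IH(1) by (intro finite_SigmaI) auto
  have "mfps_coeff (\<Prod>b\<in>insert x B. power_sum (k b)) m =
      (\<Sum>p\<in>?I. of_nat (card (case p of (i, b) \<Rightarrow> colourings k B b)))"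
    using insert.hyps by (simp add: mfps_coeff_power_sum_mult(2)[OF kx] IH(2) case_prod_beta)
  also have "\<dots> = of_nat (card ?S)"
    by (subst card_SigmaI) (use mfps_coeff_power_sum_mult(1)[OF kx] IH(1) in auto)
  finally show ?case
    using bij_betw_same_card[OF bij] bij_betw_finite[OF bij] fin by simp
qed

text \<open>\<open>X\<close> is the set of factors that contribute the fresh variable
  \<open>r\<close>; their degrees must add up to \<open>l\<close>, and the other factors produce
  \<open>m\<close>. Positivity of \<open>k\<close> ensures that a factor with colour
  \<open>r\<close> is visible in the monomial. With \<open>r\<close> as the last block of a
  composition, this is the step behind the recursion.\<close>

lemma mfps_coeff_prod_power_sum_add_single:
  assumes fin: "finite B" and pos: "\<And>b. b \<in> B \<Longrightarrow> k b > 0" and r: "r \<notin> Poly_Mapping.keys m"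
  shows "mfps_coeff (\<Prod>b\<in>B. power_sum (k b)) (m + Poly_Mapping.single r l) =
    (\<Sum>X | X \<subseteq> B \<and> sum k X = l. mfps_coeff (\<Prod>b\<in>B - X. power_sum (k b)) m)"
proof -
  let ?XS = "{X. X \<subseteq> B \<and> sum k X = l}"
  let ?S = "Sigma ?XS (\<lambda>X. colourings k (B - X) m)"
  have split: "monom_of k B f = Poly_Mapping.single r (sum k X) + monom_of k (B - X) g"
    if "X \<subseteq> B" "\<And>b. b \<in> X \<Longrightarrow> f b = r" "\<And>b. b \<in> B - X \<Longrightarrow> f b = g b" for X f g
  proof -
    have "monom_of k B f = monom_of k X f + monom_of k (B - X) f"
      unfolding monom_of_def using that(1) fin by (simp add: sum.subset_diff add.commute)
    also have "monom_of k X f = Poly_Mapping.single r (sum k X)"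
      unfolding monom_of_def using that(2) finite_subset[OF that(1) fin]
      by (intro poly_mapping_eqI) (simp add: lookup_sum_single lookup_single when_def)
    also have "monom_of k (B - X) f = monom_of k (B - X) g"
      using that(3) by (rule monom_of_cong)
    finally show ?thesis .
  qed
  have ne: "g b \<noteq> r" if "X \<subseteq> B" "g \<in> colourings k (B - X) m" "b \<in> B - X" for X g b
  proof
    assume "g b = r"
    have "0 = Poly_Mapping.lookup (monom_of k (B - X) g) r"
      using that r by (simp add: colourings_def in_keys_iff)
    also have "\<dots> = sum k {b \<in> B - X. g b = r}"
      unfolding monom_of_def using fin by (simp add: lookup_sum_single)
    finally have "sum k {b \<in> B - X. g b = r} = 0" by simp
    then have "k b = 0" using \<open>g b = r\<close> that fin by auto
    then show False using pos[of b] that by auto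
  qed
  have size: "sum k {b \<in> B. f b = r} = l" if "f \<in> colourings k B (m + Poly_Mapping.single r l)" for f
  proof -
    have "sum k {b \<in> B. f b = r} = Poly_Mapping.lookup (monom_of k B f) r"
      unfolding monom_of_def using fin by (simp add: lookup_sum_single)
    also have "\<dots> = l" using that r by (simp add: colourings_def lookup_add in_keys_iff)
    finally show ?thesis .
  qed
  have rest: "restrict f (B - {b \<in> B. f b = r}) \<in> colourings k (B - {b \<in> B. f b = r}) m"
    if f: "f \<in> colourings k B (m + Poly_Mapping.single r l)" for f
  proof -
    let ?X = "{b \<in> B. f b = r}"
    have "m + Poly_Mapping.single r l = monom_of k B f" using f by (simp add: colourings_def)
    also have "\<dots> = Poly_Mapping.single r (sum k ?X) + monom_of k (B - ?X) (restrict f (B - ?X))"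
      by (rule split) auto
    also have "sum k ?X = l" by (rule size[OF f])
    finally have "m = monom_of k (B - ?X) (restrict f (B - ?X))"
      by (rule add_left_imp_eq[OF trans[OF add.commute]])
    moreover have "restrict f (B - ?X) \<in> (B - ?X) \<rightarrow>\<^sub>E UNIV" by auto
    ultimately show ?thesis unfolding colourings_def by blast
  qed
  have glue: "(\<lambda>b. if b \<in> X then r else g b) \<in> colourings k B (m + Poly_Mapping.single r l)"
    if "X \<in> ?XS" "g \<in> colourings k (B - X) m" for X g
    using that split[of X "\<lambda>b. if b \<in> X then r else g b" g]
    by (auto simp: colourings_def PiE_def extensional_def add.commute)
  have bij: "bij_betw (\<lambda>(X, g) b. if b \<in> X then r else g b) ?S
      (colourings k B (m + Poly_Mapping.single r l))"
  proof (rule bij_betw_byWitness[where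
        f' = "\<lambda>f. ({b \<in> B. f b = r}, restrict f (B - {b \<in> B. f b = r}))"], goal_cases)
    case 1
    show ?case
    proof (clarify, rule conjI, goal_cases)
      case (1 X g)
      then show ?case using ne[of X g] by auto
    next
      case (2 X g)
      have "{b \<in> B. (if b \<in> X then r else g b) = r} = X"
        using 2 ne[of X g] by auto
      then show ?case using 2 by (auto simp: colourings_def PiE_def extensional_def fun_eq_iff)
    qed
  next
    case 2
    show ?case by (auto simp: colourings_def PiE_def extensional_def fun_eq_iff)
  next
    case 3
    show ?case using glue by auto
  next
    case 4
    have "({b \<in> B. f b = r}, restrict f (B - {b \<in> B. f b = r})) \<in> ?S"
      if "f \<in> colourings k B (m + Poly_Mapping.single r l)" for f
      using rest[OF that] size[OF that] by blast
    then show ?case by blast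
  qed
  have finX: "finite ?XS" using fin by simp
  have coeff: "finite (colourings k (B - X) m) \<and>
      mfps_coeff (\<Prod>b\<in>B - X. power_sum (k b)) m = of_nat (card (colourings k (B - X) m))" for X
    by (rule mfps_coeff_prod_power_sum) (use fin pos in auto)
  have "mfps_coeff (\<Prod>b\<in>B. power_sum (k b)) (m + Poly_Mapping.single r l) = of_nat (card ?S)"
    using mfps_coeff_prod_power_sum[OF fin pos] bij_betw_same_card[OF bij] by simp
  also have "\<dots> = (\<Sum>X\<in>?XS. of_nat (card (colourings k (B - X) m)))"
    by (subst card_SigmaI) (use finX coeff in auto)
  finally show ?thesis using coeff by simp
qed

section \<open>Binomial convolutions of trigonometric coefficients\<close>

lemma sum_Pow_card:
  fixes f :: "nat \<Rightarrow> 'a::comm_semiring_1"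
  assumes "finite B"
  shows "(\<Sum>X\<in>Pow B. f (card X)) = (\<Sum>i\<le>card B. of_nat (card B choose i) * f i)"
proof -
  have "(\<Sum>X\<in>Pow B. f (card X)) = (\<Sum>i\<le>card B. \<Sum>X | X \<in> Pow B \<and> card X = i. f (card X))"
    by (rule sum.group[symmetric]) (use assms in \<open>auto intro: card_mono\<close>)
  also have "\<dots> = (\<Sum>i\<le>card B. of_nat (card B choose i) * f i)"
    using n_subsets[OF assms] by (intro sum.cong) auto
  finally show ?thesis .
qed

lemma sum_Pow_minus_one_power:
  assumes "finite B"
  shows "(\<Sum>X\<in>Pow B. (-1) ^ card X :: 'a::comm_ring_1) = (if B = {} then 1 else 0)"
proof (cases "B = {}")
  case False
  then have "card B > 0" using assms by auto
  then have "(\<Sum>i\<le>card B. (-1) ^ i * of_nat (card B choose i)) = (0 :: 'a)"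
    by (rule choose_alternating_sum)
  then show ?thesis using False by (simp add: sum_Pow_card[OF assms] mult.commute)
qed simp

text \<open>These four sequences are the coefficients of cos, sin, sec and tan as exponential
  generating functions, so that binomial convolution becomes multiplication of power series.\<close>

definition cosn :: "nat \<Rightarrow> rat" where "cosn k = (if even k then (-1) ^ (k div 2) else 0)"
definition sinn :: "nat \<Rightarrow> rat" where "sinn k = (if odd k then (-1) ^ (k div 2) else 0)"
definition secn :: "nat \<Rightarrow> rat" where "secn k = fact k * fps_nth (inverse (fps_cos 1)) k"
definition tann :: "nat \<Rightarrow> rat" where "tann k = fact k * fps_nth (fps_tan 1) k"

lemma euler_number_eq: "euler_number k = secn k + tann k"
  by (simp add: euler_number_def secn_def tann_def algebra_simps)

lemma cosn_eq_fps_nth: "cosn k = fact k * fps_nth (fps_cos 1) k"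
  by (simp add: cosn_def fps_cos_def)

lemma sinn_eq_fps_nth: "sinn k = fact k * fps_nth (fps_sin 1) k"
  by (auto simp: sinn_def fps_sin_def elim!: oddE)

lemma fps_cos_mult_inverse: "fps_cos 1 * inverse (fps_cos (1::rat)) = 1"
  by (rule inverse_mult_eq_1') simp

lemma fps_tan_eq: "fps_tan 1 = fps_sin 1 * inverse (fps_cos (1::rat))"
  by (simp add: fps_tan_def fps_divide_unit)

lemma fps_cos_mult_tan: "fps_cos 1 * fps_tan (1::rat) = fps_sin 1"
  unfolding fps_tan_eq using fps_cos_mult_inverse by (simp add: algebra_simps)

lemma fps_cos_add_sin_mult_tan: "fps_cos 1 + fps_sin 1 * fps_tan (1::rat) = inverse (fps_cos 1)"
proof -
  have "fps_cos 1 + fps_sin 1 * fps_tan (1::rat) =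
      ((fps_cos 1)\<^sup>2 + (fps_sin 1)\<^sup>2) * inverse (fps_cos 1)"
    unfolding fps_tan_eq using fps_cos_mult_inverse
    by (simp add: distrib_right power2_eq_square mult.assoc)
  also have "\<dots> = inverse (fps_cos 1)" by (simp add: fps_sin_cos_sum_of_squares)
  finally show ?thesis .
qed

lemma binomial_convolution:
  fixes a b :: "rat fps"
  shows "(\<Sum>j\<le>n. of_nat (n choose j) * ((fact j * fps_nth a j) * (fact (n - j) * fps_nth b (n - j))))
    = fact n * fps_nth (a * b) n"
  unfolding fps_mult_nth sum_distrib_left atLeast0AtMost
  by (intro sum.cong) (auto simp: binomial_fact)

lemma binomial_cosn_secn:
  "(\<Sum>j\<le>n. of_nat (n choose j) * (cosn j * secn (n - j))) = (if n = 0 then 1 else 0)"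
  unfolding cosn_eq_fps_nth secn_def binomial_convolution fps_cos_mult_inverse by simp

lemma binomial_sinn_secn: "(\<Sum>j\<le>n. of_nat (n choose j) * (sinn j * secn (n - j))) = tann n"
  unfolding sinn_eq_fps_nth secn_def binomial_convolution tann_def fps_tan_eq ..

lemma binomial_cosn_tann: "(\<Sum>j\<le>n. of_nat (n choose j) * (cosn j * tann (n - j))) = sinn n"
  unfolding cosn_eq_fps_nth tann_def binomial_convolution fps_cos_mult_tan sinn_eq_fps_nth ..

lemma binomial_sinn_tann:
  "cosn n + (\<Sum>j\<le>n. of_nat (n choose j) * (sinn j * tann (n - j))) = secn n"
  unfolding sinn_eq_fps_nth tann_def binomial_convolution secn_def
    fps_cos_add_sin_mult_tan[symmetric] cosn_eq_fps_nth by (simp add: algebra_simps)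

lemma fps_nth_cos_odd: "odd j \<Longrightarrow> fps_nth (fps_cos 1) j = (0 :: rat)"
  by (simp add: fps_cos_def)

text \<open>Division by an even series with constant term 1 preserves parity: the coefficient of
  \<open>c * f\<close> at \<open>j\<close> is that of \<open>f\<close> plus terms with coefficients
  of \<open>f\<close> at smaller indices of the same parity, which vanish by induction. The flag
  \<open>p\<close> serves secant and tangent at once.\<close>

lemma fps_parity_cancel:
  fixes c f :: "rat fps"
  assumes c: "fps_nth c 0 = 1" "\<And>j. odd j \<Longrightarrow> fps_nth c j = 0"
    and cf: "\<And>j. even j = p \<Longrightarrow> fps_nth (c * f) j = 0"
  shows "even j = p \<Longrightarrow> fps_nth f j = 0"
proof (induction j rule: less_induct)
  case (less j)
  have "(\<Sum>i\<in>{0..j}. fps_nth c i * fps_nth f (j - i)) = (\<Sum>i\<in>{0}. fps_nth c i * fps_nth f (j - i))"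
  proof (rule sum.mono_neutral_right)
    show "\<forall>i\<in>{0..j} - {0}. fps_nth c i * fps_nth f (j - i) = 0"
    proof
      fix i assume i: "i \<in> {0..j} - {0}"
      show "fps_nth c i * fps_nth f (j - i) = 0"
      proof (cases "odd i")
        case True then show ?thesis using c by simp
      next
        case False
        then have "fps_nth f (j - i) = 0" using i less by (intro less.IH) auto
        then show ?thesis by simp
      qed
    qed
  qed auto
  then show ?case using cf[OF less.prems] c by (simp add: fps_mult_nth)
qed

lemma secn_odd:
  assumes "odd k"
  shows "secn k = 0"
proof -
  have "fps_nth (inverse (fps_cos 1)) k = (0 :: rat)"
    by (rule fps_parity_cancel[of "fps_cos 1" False])
       (use assms in \<open>auto simp: fps_cos_mult_inverse fps_nth_cos_odd odd_pos\<close>)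
  then show ?thesis by (simp add: secn_def)
qed

lemma tann_even:
  assumes "even k"
  shows "tann k = 0"
proof -
  have "fps_nth (fps_tan 1) k = (0 :: rat)"
    by (rule fps_parity_cancel[of "fps_cos 1" True])
       (use assms in \<open>auto simp: fps_cos_mult_tan fps_nth_cos_odd fps_sin_def\<close>)
  then show ?thesis by (simp add: tann_def)
qed

lemma secn_0 [simp]: "secn 0 = 1" by (simp add: secn_def)
lemma tann_0 [simp]: "tann 0 = 0" by (simp add: tann_even)

section \<open>Parity-graded set functions\<close>

definition evens :: "('b \<Rightarrow> nat) \<Rightarrow> 'b set \<Rightarrow> 'b set" where "evens k B = {b \<in> B. even (k b)}"
definition odds :: "('b \<Rightarrow> nat) \<Rightarrow> 'b set \<Rightarrow> 'b set" where "odds k B = {b \<in> B. odd (k b)}"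
definition part_sign :: "('b \<Rightarrow> nat) \<Rightarrow> 'b set \<Rightarrow> rat" where "part_sign k B = (\<Prod>b\<in>B. (-1) ^ (k b div 2))"

lemma cosn_sinn_add_even: "even a \<Longrightarrow> cosn (a + b) = (-1) ^ (a div 2) * cosn b"
  "even a \<Longrightarrow> sinn (a + b) = (-1) ^ (a div 2) * sinn b"
  by (auto simp: cosn_def sinn_def power_add elim!: evenE)

text \<open>These are the real and imaginary parts of one identity: i^k equals (-1)^(k div 2), times
  i if k is odd, and this is multiplied over all parts.\<close>

lemma cosn_sinn_sum:
  assumes "finite X"
  shows "cosn (sum k X) = part_sign k X * cosn (card (odds k X)) \<and>
    sinn (sum k X) = part_sign k X * sinn (card (odds k X))"
proof -
  \<comment> \<open>The offset \<open>r\<close> takes up the unit left over from each odd part,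
    which a statement with \<open>r = 0\<close> could not carry through the induction.\<close>
  have "cosn (sum k X + r) = part_sign k X * cosn (card (odds k X) + r) \<and>
    sinn (sum k X + r) = part_sign k X * sinn (card (odds k X) + r)" for r
    using assms
  proof (induction X arbitrary: r rule: finite_induct)
    case empty
    then show ?case by (simp add: part_sign_def odds_def)
  next
    case (insert x X)
    have [simp]: "finite (odds k X)" "x \<notin> odds k X" using insert by (auto simp: odds_def)
    have E: "part_sign k (insert x X) = (-1) ^ (k x div 2) * part_sign k X"
      using insert by (simp add: part_sign_def)
    show ?case
    proof (cases "even (k x)")
      case True
      then have "odds k (insert x X) = odds k X" by (auto simp: odds_def)
      then show ?thesis using insert True by (simp add: E cosn_sinn_add_even add.assoc)
    next
      case False
      then have O: "odds k (insert x X) = insert x (odds k X)" by (auto simp: odds_def)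
      obtain a where a: "k x = 2 * a + 1" using False by (elim oddE)
      have "sum k (insert x X) + r = 2 * a + (sum k X + (1 + r))" using insert a by simp
      then have "cosn (sum k (insert x X) + r) = (-1) ^ a * cosn (sum k X + (1 + r))"
        "sinn (sum k (insert x X) + r) = (-1) ^ a * sinn (sum k X + (1 + r))"
        by (simp_all only: cosn_sinn_add_even dvd_triv_left nonzero_mult_div_cancel_left[of 2, simplified])
      then show ?thesis using insert.IH[of "1 + r"] a by (simp add: O E)
    qed
  qed
  from this[of 0] show ?thesis by simp
qed

text \<open>A subset of \<open>B\<close> is a pair of a subset of the even parts and a subset of the
  odd parts, and the signs multiply to that of \<open>B\<close>. So the convolution splits into two
  independent binomial convolutions.\<close>

lemma graded_convolution:
  fixes u v u' v' :: "nat \<Rightarrow> rat"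
  assumes fin: "finite B"
  shows "(\<Sum>X\<in>Pow B. (part_sign k X * u (card (evens k X)) * v (card (odds k X))) *
      (part_sign k (B - X) * u' (card (evens k (B - X))) * v' (card (odds k (B - X))))) =
    part_sign k B * (\<Sum>i\<le>card (evens k B). of_nat (card (evens k B) choose i) *
        (u i * u' (card (evens k B) - i))) *
      (\<Sum>j\<le>card (odds k B). of_nat (card (odds k B) choose j) * (v j * v' (card (odds k B) - j)))"
proof -
  let ?E = "evens k B" and ?O = "odds k B"
  have finite_evens_odds: "finite ?E" "finite ?O" using fin by (auto simp: evens_def odds_def)
  have card_diff: "card (evens k (B - X)) = card ?E - card (evens k X)"
    "card (odds k (B - X)) = card ?O - card (odds k X)"
    "part_sign k X * part_sign k (B - X) = part_sign k B" if "X \<subseteq> B" for X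
  proof -
    have "evens k (B - X) = ?E - evens k X" "odds k (B - X) = ?O - odds k X"
      by (auto simp: evens_def odds_def)
    then show "card (evens k (B - X)) = card ?E - card (evens k X)"
      "card (odds k (B - X)) = card ?O - card (odds k X)"
      using that finite_evens_odds finite_subset[OF that fin]
      by (auto simp: evens_def odds_def intro!: card_Diff_subset)
    show "part_sign k X * part_sign k (B - X) = part_sign k B"
      unfolding part_sign_def using that fin by (simp add: prod.subset_diff mult.commute)
  qed
  define F where "F i j = part_sign k B * (u i * u' (card ?E - i)) * (v j * v' (card ?O - j))" for i j
  have "(\<Sum>X\<in>Pow B. (part_sign k X * u (card (evens k X)) * v (card (odds k X))) *
      (part_sign k (B - X) * u' (card (evens k (B - X))) * v' (card (odds k (B - X))))) =
    (\<Sum>X\<in>Pow B. F (card (evens k X)) (card (odds k X)))"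
  proof (rule sum.cong[OF refl])
    fix X assume "X \<in> Pow B"
    then have X: "X \<subseteq> B" by simp
    show "(part_sign k X * u (card (evens k X)) * v (card (odds k X))) *
      (part_sign k (B - X) * u' (card (evens k (B - X))) * v' (card (odds k (B - X)))) =
      F (card (evens k X)) (card (odds k X))"
      unfolding F_def card_diff(1,2)[OF X] card_diff(3)[OF X, symmetric] by (simp add: mult_ac)
  qed
  also have "\<dots> = (\<Sum>(P, Q)\<in>Pow ?E \<times> Pow ?O. F (card P) (card Q))"
    by (rule sum.reindex_bij_witness[of _ "\<lambda>(P, Q). P \<union> Q" "\<lambda>X. (evens k X, odds k X)"])
       (auto simp: evens_def odds_def)
  also have "\<dots> = (\<Sum>P\<in>Pow ?E. \<Sum>Q\<in>Pow ?O. F (card P) (card Q))"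
    by (simp add: sum.cartesian_product)
  also have "\<dots> = (\<Sum>P\<in>Pow ?E. \<Sum>j\<le>card ?O. of_nat (card ?O choose j) * F (card P) j)"
    by (simp only: sum_Pow_card[OF finite_evens_odds(2)])
  also have "\<dots> = (\<Sum>i\<le>card ?E. of_nat (card ?E choose i) *
      (\<Sum>j\<le>card ?O. of_nat (card ?O choose j) * F i j))"
    by (rule sum_Pow_card[OF finite_evens_odds(1)])
  also have "\<dots> = part_sign k B * (\<Sum>i\<le>card ?E. of_nat (card ?E choose i) * (u i * u' (card ?E - i))) *
      (\<Sum>j\<le>card ?O. of_nat (card ?O choose j) * (v j * v' (card ?O - j)))"
    by (simp add: F_def sum_product sum_distrib_left sum_distrib_right mult_ac)
  finally show ?thesis .
qed

text \<open>The convolution inverse of \<open>cosn\<close> of the sum of parts: (-1)^e inverts the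
  constant 1 on the even parts, and \<open>secn\<close> inverts \<open>cosn\<close> on the odd
  ones.\<close>

definition secant_val :: "('b \<Rightarrow> nat) \<Rightarrow> 'b set \<Rightarrow> rat" where
  "secant_val k B = part_sign k B * (-1) ^ card (evens k B) * secn (card (odds k B))"

text \<open>The convolution of \<open>sinn\<close> of the sum with \<open>secant_val\<close>: on the
  even parts the constant 1 meets its inverse and leaves the delta at 0, on the odd parts sin meets
  sec.\<close>

definition tangent_val :: "('b \<Rightarrow> nat) \<Rightarrow> 'b set \<Rightarrow> rat" where
  "tangent_val k B = part_sign k B * (if card (evens k B) = 0 then 1 else 0) * tann (card (odds k B))"

text \<open>The factor 1 keeps the summand in the shape \<open>u i * u' (n - i)\<close> required by
  \<open>graded_convolution\<close>.\<close>

lemma binomial_minus_one: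
  "(\<Sum>i\<le>n. of_nat (n choose i) * (1 * (-1) ^ (n - i))) = (if n = 0 then 1 else 0 :: rat)"
  using binomial_ring[of "1::rat" "-1" n] by (simp add: power_0_left)

lemma binomial_delta:
  "(\<Sum>i\<le>n. of_nat (n choose i) * (1 * (if n - i = 0 then 1 else 0))) = (1 :: rat)"
proof -
  have "(\<Sum>i\<le>n. of_nat (n choose i) * (1 * (if n - i = 0 then 1 else 0))) =
      (\<Sum>i\<in>{n}. of_nat (n choose i) * (1 * (if n - i = 0 then 1 else 0 :: rat)))"
    by (rule sum.mono_neutral_right) auto
  then show ?thesis by simp
qed

context
  fixes B :: "'b set" and k :: "'b \<Rightarrow> nat"
  assumes fin: "finite B"
begin

lemma finite_evens_odds: "finite (evens k B)" "finite (odds k B)"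
  using fin by (auto simp: evens_def odds_def)

lemma evens_odds_empty: "evens k B = {} \<and> odds k B = {} \<longleftrightarrow> B = {}"
  by (auto simp: evens_def odds_def)

lemma cosn_sinn_sum_subset:
  assumes "X \<subseteq> B"
  shows "cosn (sum k X) = part_sign k X * (\<lambda>_. 1) (card (evens k X)) * cosn (card (odds k X))"
    "sinn (sum k X) = part_sign k X * (\<lambda>_. 1) (card (evens k X)) * sinn (card (odds k X))"
  using cosn_sinn_sum[OF finite_subset[OF assms fin], of k] by auto

lemma convolution_cosn_secant_val:
  "(\<Sum>X\<in>Pow B. cosn (sum k X) * secant_val k (B - X)) = (if B = {} then 1 else 0)"
proof -
  have "(\<Sum>X\<in>Pow B. cosn (sum k X) * secant_val k (B - X)) =
    part_sign k B * (if card (evens k B) = 0 then 1 else 0) * (if card (odds k B) = 0 then 1 else 0)"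
    unfolding secant_val_def
    \<comment> \<open>The closed form is unfolded backwards: each factor becomes a binomial sum, and
      the product of both sums becomes the sum over subsets.\<close>
    by (subst binomial_minus_one[symmetric], subst binomial_cosn_secn[symmetric],
        subst graded_convolution[OF fin, symmetric])
       (intro sum.cong refl, simp add: cosn_sinn_sum_subset)
  then show ?thesis using finite_evens_odds evens_odds_empty by (auto simp: part_sign_def)
qed

lemma convolution_sinn_secant_val: "(\<Sum>X\<in>Pow B. sinn (sum k X) * secant_val k (B - X)) = tangent_val k B"
  unfolding secant_val_def tangent_val_def
  by (subst binomial_minus_one[symmetric], subst binomial_sinn_secn[symmetric],
      subst graded_convolution[OF fin, symmetric])
     (intro sum.cong refl, simp add: cosn_sinn_sum_subset)

lemma convolution_cosn_tangent_val: "(\<Sum>X\<in>Pow B. cosn (sum k X) * tangent_val k (B - X)) = sinn (sum k B)"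
proof -
  have "sinn (sum k B) = part_sign k B * 1 * sinn (card (odds k B))"
    using cosn_sinn_sum[OF fin, of k] by simp
  also have "\<dots> = (\<Sum>X\<in>Pow B. cosn (sum k X) * tangent_val k (B - X))"
    unfolding tangent_val_def
    by (subst binomial_delta[of "card (evens k B)", symmetric], subst binomial_cosn_tann[symmetric],
        subst graded_convolution[OF fin, symmetric])
       (intro sum.cong refl, simp add: cosn_sinn_sum_subset)
  finally show ?thesis ..
qed

text \<open>On the even parts the delta in \<open>tangent_val\<close> is convolved with the constant
  1 and gives 1, so the even parts leave no trace except their signs.\<close>

lemma convolution_sinn_tangent_val:
  "cosn (sum k B) + (\<Sum>X\<in>Pow B. sinn (sum k X) * tangent_val k (B - X)) = part_sign k B * secn (card (odds k B))"
proof -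
  have "part_sign k B * 1 * (\<Sum>j\<le>card (odds k B). of_nat (card (odds k B) choose j) *
      (sinn j * tann (card (odds k B) - j))) = (\<Sum>X\<in>Pow B. sinn (sum k X) * tangent_val k (B - X))"
    unfolding tangent_val_def
    by (subst binomial_delta[of "card (evens k B)", symmetric],
        subst graded_convolution[OF fin, symmetric])
       (intro sum.cong refl, simp add: cosn_sinn_sum_subset)
  then show ?thesis
    unfolding binomial_sinn_tann[symmetric] using cosn_sinn_sum[OF fin, of k]
    by (simp add: distrib_left)
qed

end

section \<open>Alternating sums over compositions\<close>

text \<open>The prescribed descent set: \<open>c = False\<close> belongs to alternating tableaux,
  \<open>c = True\<close> to reverse alternating ones.\<close>

definition parity_set :: "bool \<Rightarrow> nat \<Rightarrow> nat set" where
  "parity_set c n = {s. 1 \<le> s \<and> s < n \<and> even s = c}"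

text \<open>
  The monomial whose exponents are the block lengths of the composition of \<open>n\<close> with set of partial
  sums \<open>S\<close>: position \<open>j\<close> lies in the block with index \<open>card {s \<in> S. s < j}\<close>.
\<close>

definition comp_monom :: "nat \<Rightarrow> nat set \<Rightarrow> nat \<Rightarrow>\<^sub>0 nat" where
  "comp_monom n S = (\<Sum>j\<in>{1..n}. Poly_Mapping.single (card {s \<in> S. s < j}) 1)"

definition alt_functional :: "bool \<Rightarrow> nat \<Rightarrow> rat mfps \<Rightarrow> rat" where
  "alt_functional c n f =
    (\<Sum>S\<in>Pow (parity_set c n). (-1) ^ card (parity_set c n - S) * mfps_coeff f (comp_monom n S))"

lemma finite_parity_set [simp]: "finite (parity_set c n)"
  by (rule finite_subset[of _ "{..<n}"]) (auto simp: parity_set_def)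

lemma parity_set_Suc:
  "parity_set c (Suc n) = (if 1 \<le> n \<and> even n = c then insert n (parity_set c n) else parity_set c n)"
  by (auto simp: parity_set_def less_Suc_eq)

lemma card_parity_set: "card (parity_set c n) = (if c then (n - 1) div 2 else n div 2)"
proof (induction n)
  case 0
  then show ?case by (simp add: parity_set_def)
next
  case (Suc n)
  have "n \<notin> parity_set c n" by (simp add: parity_set_def)
  then have "card (parity_set c (Suc n)) =
      (if 1 \<le> n \<and> even n = c then Suc (card (parity_set c n)) else card (parity_set c n))"
    by (simp add: parity_set_Suc)
  then show ?case unfolding Suc.IH by (cases c; cases "even n") (auto elim!: evenE oddE)
qed

lemma sum_single_one: "(\<Sum>j\<in>A. Poly_Mapping.single r 1) = Poly_Mapping.single r (card A)"
  for r :: nat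
  by (induction A rule: infinite_finite_induct) (simp_all add: single_add[symmetric] del: sum_constant)

lemma comp_monom_empty: "comp_monom n {} = Poly_Mapping.single 0 n"
  using sum_single_one[of 0 "{1..n}"] by (simp add: comp_monom_def)

lemma keys_comp_monom:
  assumes "finite S"
  shows "Poly_Mapping.keys (comp_monom n S) \<subseteq> {..card S}"
proof -
  have "Poly_Mapping.lookup (comp_monom n S) r = 0" if "r > card S" for r
  proof -
    have "card {s \<in> S. s < j} \<noteq> r" for j
      using card_mono[OF assms, of "{s \<in> S. s < j}"] that by auto
    then show ?thesis by (simp add: comp_monom_def lookup_sum lookup_single when_def)
  qed
  then show ?thesis by (metis atMost_iff in_keys_iff not_le subsetI)
qed

text \<open>The new largest partial sum \<open>s\<close> leaves the blocks of the positions up to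
  \<open>s\<close> unchanged. They have indices at most \<open>card S\<close>, so the positions
  after \<open>s\<close> form a block with a fresh index.\<close>

lemma comp_monom_insert:
  assumes "S \<subseteq> {..<s}" "s \<le> n"
  shows "comp_monom n (insert s S) = comp_monom s S + Poly_Mapping.single (Suc (card S)) (n - s)"
proof -
  have fin: "finite S" using assms finite_subset by blast
  have "{1..n} = {1..s} \<union> {s<..n}" using assms by auto
  then have "comp_monom n (insert s S) =
      (\<Sum>j\<in>{1..s}. Poly_Mapping.single (card {t \<in> insert s S. t < j}) (1 :: nat)) +
      (\<Sum>j\<in>{s<..n}. Poly_Mapping.single (card {t \<in> insert s S. t < j}) (1 :: nat))"
    unfolding comp_monom_def by (simp only:) (rule sum.union_disjoint, auto)
  also have "(\<Sum>j\<in>{1..s}. Poly_Mapping.single (card {t \<in> insert s S. t < j}) (1 :: nat)) = comp_monom s S"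
    unfolding comp_monom_def
    by (intro sum.cong refl arg_cong2[of _ _ _ _ Poly_Mapping.single] arg_cong[of _ _ card]) auto
  also have "(\<Sum>j\<in>{s<..n}. Poly_Mapping.single (card {t \<in> insert s S. t < j}) (1 :: nat)) =
      (\<Sum>j\<in>{s<..n}. Poly_Mapping.single (Suc (card S)) (1 :: nat))"
  proof (rule sum.cong[OF refl])
    fix j assume j: "j \<in> {s<..n}"
    then have "{t \<in> insert s S. t < j} = insert s S" using assms by force
    moreover have "s \<notin> S" using assms by auto
    ultimately show "Poly_Mapping.single (card {t \<in> insert s S. t < j}) (1 :: nat) =
        Poly_Mapping.single (Suc (card S)) (1 :: nat)" using fin by simp
  qed
  also have "\<dots> = Poly_Mapping.single (Suc (card S)) (n - s)"
    by (simp only: sum_single_one card_greaterThanAtMost)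
  finally show ?thesis .
qed

text \<open>A nonempty \<open>S\<close> amounts to its maximum \<open>s\<close> and an arbitrary
  subset of \<open>parity_set c s\<close>, because admissibility of an element below
  \<open>s\<close> does not depend on \<open>n\<close>.\<close>

lemma sum_Pow_by_Max:
  fixes F :: "nat set \<Rightarrow> rat"
  shows "(\<Sum>S\<in>Pow (parity_set c n). F S) =
    F {} + (\<Sum>s\<in>parity_set c n. \<Sum>S\<in>Pow (parity_set c s). F (insert s S))"
proof -
  have ne: "(\<Sum>S\<in>Pow (parity_set c n) - {{}}. F S) =
      (\<Sum>(s, S)\<in>Sigma (parity_set c n) (\<lambda>s. Pow (parity_set c s)). F (insert s S))"
  proof (rule sum.reindex_bij_witness[of _ "\<lambda>(s, S). insert s S" "\<lambda>S. (Max S, S - {Max S})"])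
    fix S assume S: "S \<in> Pow (parity_set c n) - {{}}"
    then have fin: "finite S" and ne: "S \<noteq> {}"
      using finite_subset[OF _ finite_parity_set] by auto
    have M: "Max S \<in> S" using fin ne by simp
    have lt: "x < Max S" if "x \<in> S - {Max S}" for x
      using Max_ge[OF fin, of x] that by (auto simp: order.strict_iff_order)
    show "(case (Max S, S - {Max S}) of (s, S) \<Rightarrow> insert s S) = S" using M by auto
    show "(case (Max S, S - {Max S}) of (s, S) \<Rightarrow> F (insert s S)) = F S"
      using M by (auto simp: insert_absorb)
    show "(Max S, S - {Max S}) \<in> Sigma (parity_set c n) (\<lambda>s. Pow (parity_set c s))"
      using S M lt by (auto simp: parity_set_def)
  next
    fix p assume p: "p \<in> Sigma (parity_set c n) (\<lambda>s. Pow (parity_set c s))"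
    then obtain s S where [simp]: "p = (s, S)" and s: "s \<in> parity_set c n" and S: "S \<subseteq> parity_set c s"
      by auto
    have fin: "finite S" using finite_subset[OF S] by simp
    have lt: "\<And>x. x \<in> S \<Longrightarrow> x < s" using S by (auto simp: parity_set_def)
    have "Max (insert s S) = s" using fin lt by (intro Max_eqI) (auto intro: less_imp_le)
    then show "(Max (case p of (s, S) \<Rightarrow> insert s S),
        (case p of (s, S) \<Rightarrow> insert s S) - {Max (case p of (s, S) \<Rightarrow> insert s S)}) = p"
      using lt by auto
    show "(case p of (s, S) \<Rightarrow> insert s S) \<in> Pow (parity_set c n) - {{}}"
      using s S lt by (auto simp: parity_set_def intro: less_trans)
  qed
  have "(\<Sum>S\<in>Pow (parity_set c n). F S) = F {} + (\<Sum>S\<in>Pow (parity_set c n) - {{}}. F S)"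
    by (rule sum.remove) auto
  then show ?thesis unfolding ne by (simp add: sum.Sigma)
qed

abbreviation power_prod :: "('b \<Rightarrow> nat) \<Rightarrow> 'b set \<Rightarrow> rat mfps" where
  "power_prod k B \<equiv> \<Prod>b\<in>B. power_sum (k b)"

lemma sum_eq_sum_imp_eq:
  fixes k :: "'b \<Rightarrow> nat"
  assumes "finite B" "\<And>b. b \<in> B \<Longrightarrow> k b > 0" "X \<subseteq> B" "sum k X = sum k B"
  shows "X = B"
proof (rule ccontr)
  assume "X \<noteq> B"
  then have "sum k (B - X) > 0"
    using assms by (intro sum_pos) auto
  moreover have "sum k B = sum k (B - X) + sum k X"
    by (rule sum.subset_diff[OF assms(3,1)])
  ultimately show False using assms(4) by simp
qed

lemma mfps_coeff_power_prod_single: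
  assumes "finite B" "\<And>b. b \<in> B \<Longrightarrow> k b > 0"
  shows "mfps_coeff (power_prod k B) (Poly_Mapping.single r (sum k B)) = 1"
proof -
  have "{X. X \<subseteq> B \<and> sum k X = sum k B} = {B}"
    using sum_eq_sum_imp_eq[of B k] assms by blast
  then show ?thesis
    using mfps_coeff_prod_power_sum_add_single[where k = k, OF assms, of r 0 "sum k B"]
    by (simp add: mfps_coeff_one)
qed

text \<open>The first term comes from the composition with a single part. Otherwise \<open>X\<close>
  is the set of power sums that fill the last block, and the largest partial sum is the total degree
  of the remaining ones.\<close>

lemma alt_functional_power_prod_rec:
  assumes fin: "finite B" and pos: "\<And>b. b \<in> B \<Longrightarrow> k b > 0"
  defines "n \<equiv> sum k B"
  shows "alt_functional c n (power_prod k B) = (-1) ^ card (parity_set c n) +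
    (\<Sum>X | X \<subseteq> B \<and> sum k (B - X) \<in> parity_set c n.
      (-1) ^ (card (parity_set c n) + card (parity_set c (sum k (B - X))) + 1) *
      alt_functional c (sum k (B - X)) (power_prod k (B - X)))"
proof -
  let ?A = "parity_set c"
  let ?sg = "\<lambda>s. (-1) ^ (card (?A n) + card (?A s) + 1) :: rat"
  have summand: "(-1) ^ card (?A n - insert s S) * mfps_coeff (power_prod k B) (comp_monom n (insert s S)) =
      (\<Sum>X | X \<subseteq> B \<and> sum k X = n - s. ?sg s * ((-1) ^ card (?A s - S) *
        mfps_coeff (power_prod k (B - X)) (comp_monom s S)))"
    if s: "s \<in> ?A n" and S: "S \<in> Pow (?A s)" for s S
  proof -
    have lt: "S \<subseteq> {..<s}" "s \<notin> S" "insert s S \<subseteq> ?A n" "s \<le> n" "finite S"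
      using s S finite_subset[of S "?A s"] by (auto simp: parity_set_def)
    have "card (?A n - insert s S) = card (?A n) - card (insert s S)"
      using lt by (intro card_Diff_subset) auto
    moreover have "card (?A s - S) = card (?A s) - card S"
      using S lt by (intro card_Diff_subset) auto
    moreover have "card (insert s S) \<le> card (?A n)" "card S \<le> card (?A s)"
      by (rule card_mono; use lt S in simp)+
    \<comment> \<open>Comparing parities avoids natural subtraction; the summand 1 stands for the
      element \<open>s\<close> itself.\<close>
    ultimately have "even (card (?A n - insert s S)) =
        even (card (?A n) + card (?A s) + 1 + card (?A s - S))"
      using lt by auto
    then have sg: "(-1) ^ card (?A n - insert s S) = ?sg s * (-1) ^ card (?A s - S)"
      unfolding power_add[symmetric] by (simp add: minus_one_power_iff)
    have "Suc (card S) \<notin> Poly_Mapping.keys (comp_monom s S)"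
      using keys_comp_monom[OF lt(5), of s] by auto
    then have "mfps_coeff (power_prod k B) (comp_monom n (insert s S)) =
        (\<Sum>X | X \<subseteq> B \<and> sum k X = n - s. mfps_coeff (power_prod k (B - X)) (comp_monom s S))"
      unfolding comp_monom_insert[OF lt(1,4)]
      by (intro mfps_coeff_prod_power_sum_add_single[where k = k, OF fin pos])
    then show ?thesis by (simp only: sg sum_distrib_left mult.assoc)
  qed
  have "alt_functional c n (power_prod k B) = (-1) ^ card (?A n) * mfps_coeff (power_prod k B) (comp_monom n {}) +
      (\<Sum>s\<in>?A n. \<Sum>S\<in>Pow (?A s). (-1) ^ card (?A n - insert s S) *
        mfps_coeff (power_prod k B) (comp_monom n (insert s S)))"
    unfolding alt_functional_def by (subst sum_Pow_by_Max) simp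
  also have "mfps_coeff (power_prod k B) (comp_monom n {}) = 1"
    unfolding comp_monom_empty n_def using mfps_coeff_power_prod_single[where k = k, OF fin pos] .
  also have "(\<Sum>s\<in>?A n. \<Sum>S\<in>Pow (?A s). (-1) ^ card (?A n - insert s S) *
        mfps_coeff (power_prod k B) (comp_monom n (insert s S))) =
      (\<Sum>s\<in>?A n. \<Sum>S\<in>Pow (?A s). \<Sum>X | X \<subseteq> B \<and> sum k X = n - s.
        ?sg s * ((-1) ^ card (?A s - S) * mfps_coeff (power_prod k (B - X)) (comp_monom s S)))"
    by (intro sum.cong refl summand)
  also have "\<dots> = (\<Sum>s\<in>?A n. \<Sum>X | X \<subseteq> B \<and> sum k X = n - s.
      ?sg s * alt_functional c s (power_prod k (B - X)))"
    by (subst sum.swap) (simp only: alt_functional_def sum_distrib_left)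
  \<comment> \<open>Since \<open>X\<close> forces \<open>s\<close> to be
    \<open>sum k (B - X)\<close>, the double sum is a sum over \<open>X\<close> alone, grouped by
    \<open>s\<close>.\<close>
  also have "\<dots> = (\<Sum>s\<in>?A n. \<Sum>X | X \<in> {X. X \<subseteq> B \<and> sum k (B - X) \<in> ?A n} \<and> sum k (B - X) = s.
      ?sg (sum k (B - X)) * alt_functional c (sum k (B - X)) (power_prod k (B - X)))"
  proof (rule sum.cong[OF refl])
    fix s assume s: "s \<in> ?A n"
    have tot: "sum k X + sum k (B - X) = n" if "X \<subseteq> B" for X
      using sum.subset_diff[OF that fin, of k] by (simp add: n_def)
    have "s < n" using s by (simp add: parity_set_def)
    have iff: "(sum k X = n - s) \<longleftrightarrow> (sum k (B - X) = s)" if "X \<subseteq> B" for X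
      using tot[OF that] \<open>s < n\<close> by linarith
    show "(\<Sum>X | X \<subseteq> B \<and> sum k X = n - s. ?sg s * alt_functional c s (power_prod k (B - X))) =
      (\<Sum>X | X \<in> {X. X \<subseteq> B \<and> sum k (B - X) \<in> ?A n} \<and> sum k (B - X) = s.
        ?sg (sum k (B - X)) * alt_functional c (sum k (B - X)) (power_prod k (B - X)))"
    proof (rule sum.cong)
      show "{X. X \<subseteq> B \<and> sum k X = n - s} =
          {X. X \<in> {X. X \<subseteq> B \<and> sum k (B - X) \<in> ?A n} \<and> sum k (B - X) = s}"
        using iff s by blast
    qed simp
  qed
  also have "\<dots> = (\<Sum>X | X \<subseteq> B \<and> sum k (B - X) \<in> ?A n.
      ?sg (sum k (B - X)) * alt_functional c (sum k (B - X)) (power_prod k (B - X)))"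
    by (rule sum.group) (use fin in auto)
  finally show ?thesis by (simp only: mult_1_right)
qed

text \<open>Here \<open>k\<close> is the length of the last block. If \<open>n\<close> has parity
  \<open>c\<close>, then \<open>k\<close> must be even and the two cardinalities differ by k/2;
  otherwise \<open>k\<close> must be odd and they differ by (k+1)/2. So the sign depends only on
  \<open>k\<close>, as the real or imaginary part of a power of i.\<close>

lemma parity_sign:
  assumes "0 < k" "k < n"
  shows "(if n - k \<in> parity_set c n
      then (-1) ^ (card (parity_set c n) + card (parity_set c (n - k)) + 1) else 0) =
    (if even n = c then - cosn k else sinn k)"
proof -
  obtain s where s: "n = s + k" "s > 0" using assms by (metis add.commute less_imp_add_positive)
  have A: "s \<in> parity_set c n \<longleftrightarrow> even s = c" "n - k = s" using s assms by (auto simp: parity_set_def)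
  show ?thesis
  proof (cases "even s = c")
    case False
    then show ?thesis using s A by (auto simp: cosn_def sinn_def)
  next
    case True
    \<comment> \<open>\<open>a\<close> is the number of admissible partial sums below
      \<open>s\<close>: 2, ..., 2a below 2a + 2, or 1, ..., 2a - 1 below 2a + 1.\<close>
    define a where "a = (if c then s div 2 - 1 else s div 2)"
    have sa: "s = (if c then 2 * a + 2 else 2 * a + 1)"
      using True s(2) by (cases c) (auto simp: a_def)
    have cs: "card (parity_set c s) = a" using sa by (auto simp: card_parity_set)
    show ?thesis
    proof (cases "even k")
      case True
      then obtain b where b: "k = 2 * b" by (elim evenE)
      have "card (parity_set c n) = a + b" using sa b s by (auto simp: card_parity_set)
      then show ?thesis using A cs s sa b by (auto simp: cosn_def power_add)
    next
      case False
      then obtain b where b: "k = 2 * b + 1" by (elim oddE)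
      have "card (parity_set c n) = a + b + 1" using sa b s by (auto simp: card_parity_set)
      then show ?thesis using A cs s sa b by (auto simp: sinn_def power_add)
    qed
  qed
qed

text \<open>For \<open>c = True\<close> the one-part composition continues the pattern of
  \<open>parity_sign\<close> to \<open>k = n\<close>, as if 0 were an admissible partial sum. For
  \<open>c = False\<close> it breaks the pattern, since 0 has the wrong parity, and becomes an
  inhomogeneous term.\<close>

lemma parity_sign_total:
  assumes "n > 0"
  shows "(-1) ^ card (parity_set c n) =
    (if odd n then sinn n else if c then - cosn n else cosn n)"
proof (cases "even n")
  case True
  then obtain a where "n = 2 * a" by (elim evenE)
  then have "n = 2 * Suc (a - 1)" using assms by simp
  then obtain a where "n = 2 * Suc a" by blast
  then show ?thesis by (auto simp: card_parity_set cosn_def)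
next
  case False
  then obtain a where "n = 2 * a + 1" by (elim oddE)
  then show ?thesis by (auto simp: card_parity_set sinn_def)
qed

lemma alt_functional_power_prod_rec':
  assumes fin: "finite B" and pos: "\<And>b. b \<in> B \<Longrightarrow> k b > 0" and "B \<noteq> {}"
  defines "n \<equiv> sum k B"
  shows "alt_functional c n (power_prod k B) = (if odd n then sinn n else if c then - cosn n else cosn n) +
    (\<Sum>X\<in>Pow B - {{}, B}. (if even n = c then - cosn (sum k X) else sinn (sum k X)) *
      alt_functional c (sum k (B - X)) (power_prod k (B - X)))"
proof -
  let ?A = "parity_set c"
  have n: "n > 0" unfolding n_def using assms by (intro sum_pos) auto
  have tot: "sum k X + sum k (B - X) = n" if "X \<subseteq> B" for X
    using sum.subset_diff[OF that fin, of k] by (simp add: n_def)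
  have sub: "{X. X \<subseteq> B \<and> sum k (B - X) \<in> ?A n} \<subseteq> Pow B - {{}, B}"
    by (auto simp: parity_set_def n_def)
  have sgn: "(if sum k (B - X) \<in> ?A n
      then (-1) ^ (card (?A n) + card (?A (sum k (B - X))) + 1) else 0) =
      (if even n = c then - cosn (sum k X) else sinn (sum k X))"
    if X: "X \<in> Pow B - {{}, B}" for X
  proof -
    have "finite X" using X fin finite_subset by auto
    have "sum k X > 0" by (rule sum_pos[OF \<open>finite X\<close>]) (use X pos in blast)+
    moreover have "sum k (B - X) > 0" by (rule sum_pos) (use X pos fin in blast)+
    moreover have "n - sum k X = sum k (B - X)" using tot[of X] X by auto
    ultimately show ?thesis
      using parity_sign[of "sum k X" n c] tot[of X] X by auto
  qed
  have "(\<Sum>X | X \<subseteq> B \<and> sum k (B - X) \<in> ?A n.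
      (-1) ^ (card (?A n) + card (?A (sum k (B - X))) + 1) *
      alt_functional c (sum k (B - X)) (power_prod k (B - X))) =
    (\<Sum>X\<in>Pow B - {{}, B}. (if even n = c then - cosn (sum k X) else sinn (sum k X)) *
      alt_functional c (sum k (B - X)) (power_prod k (B - X)))"
  proof (rule sum.mono_neutral_cong_left[OF _ sub])
    show "finite (Pow B - {{}, B})" using fin by simp
    show "\<forall>X\<in>Pow B - {{}, B} - {X. X \<subseteq> B \<and> sum k (B - X) \<in> ?A n}.
      (if even n = c then - cosn (sum k X) else sinn (sum k X)) *
      alt_functional c (sum k (B - X)) (power_prod k (B - X)) = 0"
    proof
      fix X assume X: "X \<in> Pow B - {{}, B} - {X. X \<subseteq> B \<and> sum k (B - X) \<in> ?A n}"
      then show "(if even n = c then - cosn (sum k X) else sinn (sum k X)) *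
        alt_functional c (sum k (B - X)) (power_prod k (B - X)) = 0"
        using sgn[of X] by (subst sgn[symmetric]) auto
    qed
    fix X assume X: "X \<in> {X. X \<subseteq> B \<and> sum k (B - X) \<in> ?A n}"
    then have "X \<in> Pow B - {{}, B}" using sub by blast
    from sgn[OF this] X
    show "(-1) ^ (card (?A n) + card (?A (sum k (B - X))) + 1) *
        alt_functional c (sum k (B - X)) (power_prod k (B - X)) =
        (if even n = c then - cosn (sum k X) else sinn (sum k X)) *
        alt_functional c (sum k (B - X)) (power_prod k (B - X))" by simp
  qed
  then show ?thesis
    using alt_functional_power_prod_rec[where k = k and c = c, OF fin pos] parity_sign_total[OF n, of c]
    by (simp add: n_def)
qed

lemma sum_Pow_split_ends:
  assumes "finite B" "B \<noteq> {}"
  shows "(\<Sum>X\<in>Pow B. F X :: rat) = F {} + F B + (\<Sum>X\<in>Pow B - {{}, B}. F X)"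
proof -
  have "(\<Sum>X\<in>Pow B. F X) = F {} + (\<Sum>X\<in>Pow B - {{}}. F X)"
    using assms by (intro sum.remove) auto
  also have "(\<Sum>X\<in>Pow B - {{}}. F X) = F B + (\<Sum>X\<in>Pow B - {{}} - {B}. F X)"
    using assms by (intro sum.remove) auto
  also have "Pow B - {{}} - {B} = Pow B - {{}, B}" by auto
  finally show ?thesis by (simp add: add.assoc)
qed

section \<open>Closed forms of the functional on products of power sums\<close>

lemma cosn_odd: "odd n \<Longrightarrow> cosn n = 0" and sinn_even: "even n \<Longrightarrow> sinn n = 0"
  by (auto simp: cosn_def sinn_def)

lemma secant_val_empty [simp]: "secant_val k {} = 1" and tangent_val_empty [simp]: "tangent_val k {} = 0"
  by (simp_all add: secant_val_def tangent_val_def part_sign_def evens_def odds_def)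

lemma alt_functional_zero: "alt_functional c 0 (power_prod k {}) = 1"
  by (simp add: alt_functional_def parity_set_def comp_monom_def mfps_coeff_one)

text \<open>In the full convolution with \<open>cosn\<close> the term \<open>X = {}\<close> is the
  functional itself and the term \<open>X = B\<close> is \<open>cosn (sum k B)\<close>, so for
  nonempty \<open>B\<close> the recursion says that this convolution vanishes;
  \<open>secant_val\<close> solves the same equation. As \<open>cosn\<close> vanishes at odd
  numbers, the induction only meets sets \<open>B - X\<close> of even sum.\<close>

lemma alt_functional_True_even:
  assumes "finite B" "\<And>b. b \<in> B \<Longrightarrow> k b > 0" "even (sum k B)"
  shows "alt_functional True (sum k B) (power_prod k B) = secant_val k B"
  using assms
proof (induction B rule: finite_psubset_induct)
  case (psubset B)
  show ?case
  proof (cases "B = {}")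
    case True
    then show ?thesis using alt_functional_zero by simp
  next
    case False
    have IH: "cosn (sum k X) * alt_functional True (sum k (B - X)) (power_prod k (B - X)) =
        cosn (sum k X) * secant_val k (B - X)" if X: "X \<in> Pow B - {{}, B}" for X
    proof (cases "even (sum k X)")
      case True
      have "sum k B = sum k (B - X) + sum k X"
        using X psubset.hyps by (intro sum.subset_diff) auto
      then have "even (sum k (B - X))" using True psubset.prems(2) by auto
      then have "alt_functional True (sum k (B - X)) (power_prod k (B - X)) = secant_val k (B - X)"
        using X psubset.prems by (intro psubset.IH) auto
      then show ?thesis by simp
    qed (simp add: cosn_odd)
    have "alt_functional True (sum k B) (power_prod k B) = - cosn (sum k B) -
        (\<Sum>X\<in>Pow B - {{}, B}. cosn (sum k X) * alt_functional True (sum k (B - X)) (power_prod k (B - X)))"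
      using alt_functional_power_prod_rec'[where k = k and c = True, OF psubset.hyps(1) psubset.prems(1) False] psubset.prems(2)
      by (simp add: sum_negf)
    also have "\<dots> = - cosn (sum k B) - (\<Sum>X\<in>Pow B - {{}, B}. cosn (sum k X) * secant_val k (B - X))"
      by (simp only: IH cong: sum.cong)
    also have "\<dots> = secant_val k B"
      using convolution_cosn_secant_val[OF psubset.hyps(1), of k] False
        sum_Pow_split_ends[OF psubset.hyps(1) False, of "\<lambda>X. cosn (sum k X) * secant_val k (B - X)"]
      by (simp add: cosn_def)
    finally show ?thesis .
  qed
qed

text \<open>No induction is involved: an odd last block leaves an even sum, where the value is
  \<open>secant_val\<close>.\<close>

lemma alt_functional_True_odd:
  assumes fin: "finite B" and pos: "\<And>b. b \<in> B \<Longrightarrow> k b > 0" and odd: "odd (sum k B)"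
  shows "alt_functional True (sum k B) (power_prod k B) = tangent_val k B"
proof -
  have ne: "B \<noteq> {}" using odd by auto
  have eq: "sinn (sum k X) * alt_functional True (sum k (B - X)) (power_prod k (B - X)) =
        sinn (sum k X) * secant_val k (B - X)" if X: "X \<in> Pow B - {{}, B}" for X
  proof (cases "odd (sum k X)")
    case True
    have "sum k B = sum k (B - X) + sum k X"
      using X fin by (intro sum.subset_diff) auto
    then have "even (sum k (B - X))" using True odd by auto
    then have "alt_functional True (sum k (B - X)) (power_prod k (B - X)) = secant_val k (B - X)"
      using X pos fin by (intro alt_functional_True_even) auto
    then show ?thesis by simp
  qed (simp add: sinn_even)
  have "alt_functional True (sum k B) (power_prod k B) = sinn (sum k B) +
      (\<Sum>X\<in>Pow B - {{}, B}. sinn (sum k X) * alt_functional True (sum k (B - X)) (power_prod k (B - X)))"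
    using alt_functional_power_prod_rec'[where k = k and c = True, OF fin pos ne] odd by simp
  also have "\<dots> = sinn (sum k B) + (\<Sum>X\<in>Pow B - {{}, B}. sinn (sum k X) * secant_val k (B - X))"
    by (simp only: eq cong: sum.cong)
  also have "\<dots> = tangent_val k B"
    using convolution_sinn_secant_val[OF fin, of k]
      sum_Pow_split_ends[OF fin ne, of "\<lambda>X. sinn (sum k X) * secant_val k (B - X)"]
    by (simp add: sinn_def)
  finally show ?thesis .
qed

text \<open>The one-part composition is now the right-hand side: convolving the solution with
  \<open>cosn\<close> must give \<open>sinn (sum k B)\<close>. The excluded \<open>X = B\<close> is
  harmless because \<open>tangent_val k {} = 0\<close>.\<close>

lemma alt_functional_False_odd:
  assumes "finite B" "\<And>b. b \<in> B \<Longrightarrow> k b > 0" "odd (sum k B)"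
  shows "alt_functional False (sum k B) (power_prod k B) = tangent_val k B"
  using assms
proof (induction B rule: finite_psubset_induct)
  case (psubset B)
  have ne: "B \<noteq> {}" using psubset.prems by auto
  have IH: "cosn (sum k X) * alt_functional False (sum k (B - X)) (power_prod k (B - X)) =
      cosn (sum k X) * tangent_val k (B - X)" if X: "X \<in> Pow B - {{}, B}" for X
  proof (cases "even (sum k X)")
    case True
    have "sum k B = sum k (B - X) + sum k X"
      using X psubset.hyps by (intro sum.subset_diff) auto
    then have "odd (sum k (B - X))" using True psubset.prems(2) by auto
    then have "alt_functional False (sum k (B - X)) (power_prod k (B - X)) = tangent_val k (B - X)"
      using X psubset.prems by (intro psubset.IH) auto
    then show ?thesis by simp
  qed (simp add: cosn_odd)
  have "alt_functional False (sum k B) (power_prod k B) = sinn (sum k B) -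
      (\<Sum>X\<in>Pow B - {{}, B}. cosn (sum k X) * alt_functional False (sum k (B - X)) (power_prod k (B - X)))"
    using alt_functional_power_prod_rec'[where k = k and c = False, OF psubset.hyps(1) psubset.prems(1) ne] psubset.prems(2)
    by (simp add: sum_negf)
  also have "\<dots> = sinn (sum k B) - (\<Sum>X\<in>Pow B - {{}, B}. cosn (sum k X) * tangent_val k (B - X))"
    by (simp only: IH cong: sum.cong)
  also have "\<dots> = tangent_val k B"
    using convolution_cosn_tangent_val[OF psubset.hyps(1), of k]
      sum_Pow_split_ends[OF psubset.hyps(1) ne, of "\<lambda>X. cosn (sum k X) * tangent_val k (B - X)"]
    by (simp add: cosn_def)
  finally show ?case .
qed

text \<open>An odd last block leaves an odd sum, where the value is \<open>tangent_val\<close>. The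
  inhomogeneous term \<open>cosn (sum k B)\<close> completes the identity cos + sin * tan =
  sec.\<close>

lemma alt_functional_False_even:
  assumes fin: "finite B" and pos: "\<And>b. b \<in> B \<Longrightarrow> k b > 0" and even: "even (sum k B)"
  shows "alt_functional False (sum k B) (power_prod k B) = part_sign k B * secn (card (odds k B))"
proof (cases "B = {}")
  case True
  then show ?thesis using alt_functional_zero by (simp add: part_sign_def odds_def)
next
  case False
  have eq: "sinn (sum k X) * alt_functional False (sum k (B - X)) (power_prod k (B - X)) =
        sinn (sum k X) * tangent_val k (B - X)" if X: "X \<in> Pow B - {{}, B}" for X
  proof (cases "odd (sum k X)")
    case True
    have "sum k B = sum k (B - X) + sum k X"
      using X fin by (intro sum.subset_diff) auto
    then have "odd (sum k (B - X))" using True even by auto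
    then have "alt_functional False (sum k (B - X)) (power_prod k (B - X)) = tangent_val k (B - X)"
      using X pos fin by (intro alt_functional_False_odd) auto
    then show ?thesis by simp
  qed (simp add: sinn_even)
  have "alt_functional False (sum k B) (power_prod k B) = cosn (sum k B) +
      (\<Sum>X\<in>Pow B - {{}, B}. sinn (sum k X) * alt_functional False (sum k (B - X)) (power_prod k (B - X)))"
    using alt_functional_power_prod_rec'[where k = k and c = False, OF fin pos False] even by simp
  also have "\<dots> = cosn (sum k B) + (\<Sum>X\<in>Pow B - {{}, B}. sinn (sum k X) * tangent_val k (B - X))"
    by (simp only: eq cong: sum.cong)
  also have "\<dots> = part_sign k B * secn (card (odds k B))"
    using convolution_sinn_tangent_val[OF fin, of k]
      sum_Pow_split_ends[OF fin False, of "\<lambda>X. sinn (sum k X) * tangent_val k (B - X)"]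
    by (simp add: sinn_def)
  finally show ?thesis .
qed

section \<open>Monomial types and symmetric series\<close>

text \<open>One notion for two readings: \<open>mdeg\<close> is the degree of a monomial, while for
  a multiplicity function of a partition \<open>mdeg\<close> counts the parts and
  \<open>wt id\<close> is the size.\<close>

definition wt :: "(nat \<Rightarrow> nat) \<Rightarrow> (nat \<Rightarrow>\<^sub>0 nat) \<Rightarrow> nat" where
  "wt g a = (\<Sum>i\<in>Poly_Mapping.keys a. Poly_Mapping.lookup a i * g i)"

abbreviation mdeg :: "(nat \<Rightarrow>\<^sub>0 nat) \<Rightarrow> nat" where "mdeg \<equiv> wt (\<lambda>_. 1)"

text \<open>The multiset of nonzero exponents of \<open>a\<close>, as a multiplicity function.\<close>

definition mtype :: "(nat \<Rightarrow>\<^sub>0 nat) \<Rightarrow> (nat \<Rightarrow>\<^sub>0 nat)" where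
  "mtype a = (\<Sum>r\<in>Poly_Mapping.keys a. Poly_Mapping.single (Poly_Mapping.lookup a r) 1)"

lemma wt_superset:
  assumes "finite S" "Poly_Mapping.keys a \<subseteq> S"
  shows "wt g a = (\<Sum>i\<in>S. Poly_Mapping.lookup a i * g i)"
  unfolding wt_def using assms by (intro sum.mono_neutral_left) (auto simp: in_keys_iff)

lemma wt_add: "wt g (a + b) = wt g a + wt g b"
proof -
  let ?S = "Poly_Mapping.keys a \<union> Poly_Mapping.keys b"
  have "wt g (a + b) = (\<Sum>i\<in>?S. Poly_Mapping.lookup (a + b) i * g i)"
    by (rule wt_superset) (use Poly_Mapping.keys_add[of a b] in auto)
  also have "\<dots> = wt g a + wt g b"
    by (simp add: wt_superset[of ?S a] wt_superset[of ?S b] lookup_add distrib_right sum.distrib)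
  finally show ?thesis .
qed

lemma wt_zero [simp]: "wt g 0 = 0"
  by (simp add: wt_def)

lemma wt_single [simp]: "wt g (Poly_Mapping.single i c) = c * g i"
  by (cases "c = 0") (simp_all add: wt_def)

lemma wt_sum: "wt g (sum h A) = (\<Sum>x\<in>A. wt g (h x))"
  by (induction A rule: infinite_finite_induct) (simp_all add: wt_add)

lemma wt_mtype: "wt g (mtype a) = (\<Sum>r\<in>Poly_Mapping.keys a. g (Poly_Mapping.lookup a r))"
  by (simp add: mtype_def wt_sum)

lemma lookup_mtype:
  "Poly_Mapping.lookup (mtype a) i = card {r \<in> Poly_Mapping.keys a. Poly_Mapping.lookup a r = i}"
  unfolding mtype_def by (subst lookup_sum_single) auto

lemma zero_notin_keys_mtype: "0 \<notin> Poly_Mapping.keys (mtype a)"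
proof -
  have "{r \<in> Poly_Mapping.keys a. Poly_Mapping.lookup a r = 0} = {}" by (auto simp: in_keys_iff)
  then show ?thesis by (simp add: in_keys_iff lookup_mtype)
qed

text \<open>One element \<open>(i, j)\<close> for the copy \<open>j\<close> of the part
  \<open>i\<close>, so that a monomial in the power sums becomes
  \<open>power_prod fst (parts \<mu>)\<close>, a product over an index set.\<close>

definition parts :: "(nat \<Rightarrow>\<^sub>0 nat) \<Rightarrow> (nat \<times> nat) set" where
  "parts \<mu> = Sigma (Poly_Mapping.keys \<mu>) (\<lambda>i. {..<Poly_Mapping.lookup \<mu> i})"

lemma finite_parts [simp]: "finite (parts \<mu>)"
  by (simp add: parts_def)

lemma sum_parts: "(\<Sum>b\<in>parts \<mu>. g (fst b)) = wt g \<mu>"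
proof -
  have "(\<Sum>b\<in>parts \<mu>. g (fst b)) =
      (\<Sum>i\<in>Poly_Mapping.keys \<mu>. \<Sum>j<Poly_Mapping.lookup \<mu> i. g i)"
    unfolding parts_def by (subst sum.Sigma) (auto simp: case_prod_beta)
  then show ?thesis by (simp add: wt_def)
qed

lemma card_parts: "card (parts \<mu>) = mdeg \<mu>"
  using sum_parts[of "\<lambda>_. 1" \<mu>] by simp

lemma prod_parts:
  fixes a :: "nat \<Rightarrow> 'a::comm_ring_1"
  shows "(\<Prod>i\<in>Poly_Mapping.keys \<mu>. a i ^ Poly_Mapping.lookup \<mu> i) = (\<Prod>b\<in>parts \<mu>. a (fst b))"
proof -
  have "(\<Prod>b\<in>parts \<mu>. a (fst b)) =
      (\<Prod>i\<in>Poly_Mapping.keys \<mu>. \<Prod>j<Poly_Mapping.lookup \<mu> i. a i)"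
    unfolding parts_def by (subst prod.Sigma) (auto simp: case_prod_beta)
  then show ?thesis by simp
qed

lemma sum_single_parts: "(\<Sum>b\<in>parts \<mu>. Poly_Mapping.single (fst b) 1) = \<mu>"
proof (rule poly_mapping_eqI)
  fix i
  have "{b \<in> parts \<mu>. fst b = i} = {i} \<times> {..<Poly_Mapping.lookup \<mu> i}"
    by (auto simp: parts_def in_keys_iff)
  then show "Poly_Mapping.lookup (\<Sum>b\<in>parts \<mu>. Poly_Mapping.single (fst b) 1) i =
      Poly_Mapping.lookup \<mu> i"
    by (simp add: lookup_sum_single)
qed

lemma fst_parts_pos: "0 \<notin> Poly_Mapping.keys \<mu> \<Longrightarrow> b \<in> parts \<mu> \<Longrightarrow> fst b > 0"
  by (cases "fst b") (auto simp: parts_def)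

lemma monom_of_props:
  assumes fin: "finite B" and pos: "\<And>b. b \<in> B \<Longrightarrow> k b > 0"
  shows "Poly_Mapping.keys (monom_of k B f) = f ` B"
    and "mdeg (monom_of k B f) = sum k B"
    and "inj_on f B \<Longrightarrow> mtype (monom_of k B f) = (\<Sum>b\<in>B. Poly_Mapping.single (k b) 1)"
proof -
  show keys: "Poly_Mapping.keys (monom_of k B f) = f ` B"
  proof (rule set_eqI)
    fix r
    have "r \<in> Poly_Mapping.keys (monom_of k B f) \<longleftrightarrow> sum k {b \<in> B. f b = r} \<noteq> 0"
      unfolding in_keys_iff monom_of_def by (simp add: lookup_sum_single fin)
    also have "\<dots> \<longleftrightarrow> (\<exists>b\<in>B. f b = r \<and> k b \<noteq> 0)"
      using fin by auto
    also have "\<dots> \<longleftrightarrow> r \<in> f ` B"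
      using pos by (metis imageE imageI less_not_refl)
    finally show "r \<in> Poly_Mapping.keys (monom_of k B f) \<longleftrightarrow> r \<in> f ` B" .
  qed
  show "mdeg (monom_of k B f) = sum k B"
    by (simp add: monom_of_def wt_sum)
  assume inj: "inj_on f B"
  have look: "Poly_Mapping.lookup (monom_of k B f) (f b) = k b" if "b \<in> B" for b
  proof -
    have "{b' \<in> B. f b' = f b} = {b}" using inj that by (auto dest: inj_onD)
    then show ?thesis unfolding monom_of_def by (simp add: lookup_sum_single fin)
  qed
  show "mtype (monom_of k B f) = (\<Sum>b\<in>B. Poly_Mapping.single (k b) 1)"
    unfolding mtype_def keys by (subst sum.reindex[OF inj]) (auto simp: look intro!: sum.cong)
qed

text \<open>A monomial of the product arises by merging parts that choose the same variable. It
  therefore has at most as many variables as there are parts, and with equality nothing was merged.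
  This is the triangularity with respect to monomial types.\<close>

lemma mfps_coeff_power_prod_nonzero:
  assumes fin: "finite B" and pos: "\<And>b. b \<in> B \<Longrightarrow> k b > 0"
    and nz: "mfps_coeff (power_prod k B) a \<noteq> 0"
  shows "mdeg a = sum k B" "card (Poly_Mapping.keys a) \<le> card B"
    "card (Poly_Mapping.keys a) = card B \<Longrightarrow> mtype a = (\<Sum>b\<in>B. Poly_Mapping.single (k b) 1)"
proof -
  have "colourings k B a \<noteq> {}"
    using nz mfps_coeff_prod_power_sum[where k = k and m = a, OF fin pos] by auto
  then obtain f where f: "monom_of k B f = a" by (auto simp: colourings_def)
  have keys: "Poly_Mapping.keys a = f ` B"
    unfolding f[symmetric] by (rule monom_of_props(1)) (use fin pos in auto)
  show "mdeg a = sum k B"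
    unfolding f[symmetric] by (rule monom_of_props(2)) (use fin pos in auto)
  show "card (Poly_Mapping.keys a) \<le> card B"
    using card_image_le[OF fin, of f] keys by simp
  assume "card (Poly_Mapping.keys a) = card B"
  then have "inj_on f B" using eq_card_imp_inj_on[OF fin, of f] keys by simp
  then show "mtype a = (\<Sum>b\<in>B. Poly_Mapping.single (k b) 1)"
    unfolding f[symmetric] by (intro monom_of_props(3)) (use fin pos in auto)
qed

lemma mfps_coeff_power_prod_monom_of:
  assumes fin: "finite B" and pos: "\<And>b. b \<in> B \<Longrightarrow> k b > 0"
  shows "mfps_coeff (power_prod k B) (monom_of k B f) \<noteq> 0"
proof -
  have "restrict f B \<in> colourings k B (monom_of k B f)"
    by (auto simp: colourings_def intro!: monom_of_cong)
  then show ?thesis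
    using mfps_coeff_prod_power_sum[where k = k and m = "monom_of k B f", OF fin pos] by auto
qed

text \<open>Invariance under adjacent transpositions of variables, stated as a relation between
  exponent functions so that no permuted monomial has to be constructed.\<close>

definition adj_sym :: "rat mfps \<Rightarrow> bool" where
  "adj_sym f \<longleftrightarrow> (\<forall>r a a'. Poly_Mapping.lookup a' =
     (Poly_Mapping.lookup a)(r := Poly_Mapping.lookup a (Suc r), Suc r := Poly_Mapping.lookup a r) \<longrightarrow>
     mfps_coeff f a' = mfps_coeff f a)"

lemma adj_sym_power_prod:
  assumes fin: "finite B" and pos: "\<And>b. b \<in> B \<Longrightarrow> k b > 0"
  shows "adj_sym (power_prod k B)"
  unfolding adj_sym_def
proof (intro allI impI)
  fix r and a a' :: "nat \<Rightarrow>\<^sub>0 nat"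
  assume a': "Poly_Mapping.lookup a' =
     (Poly_Mapping.lookup a)(r := Poly_Mapping.lookup a (Suc r), Suc r := Poly_Mapping.lookup a r)"
  define \<sigma> where "\<sigma> i = (if i = r then Suc r else if i = Suc r then r else i)" for i
  have \<sigma>\<sigma>: "\<sigma> (\<sigma> i) = i" for i by (auto simp: \<sigma>_def)
  have \<sigma>_eq: "\<sigma> i = j \<longleftrightarrow> i = \<sigma> j" for i j by (auto simp: \<sigma>_def)
  have look: "Poly_Mapping.lookup a' i = Poly_Mapping.lookup a (\<sigma> i)" for i
    unfolding a' by (auto simp: \<sigma>_def)
  have look': "Poly_Mapping.lookup a i = Poly_Mapping.lookup a' (\<sigma> i)" for i
    by (simp add: look \<sigma>\<sigma>)
  have step: "monom_of k B (restrict (\<sigma> \<circ> f) B) = y"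
    if "monom_of k B f = x" "\<And>i. Poly_Mapping.lookup y i = Poly_Mapping.lookup x (\<sigma> i)" for f x y
  proof (rule poly_mapping_eqI)
    fix i
    have "monom_of k B (restrict (\<sigma> \<circ> f) B) = monom_of k B (\<sigma> \<circ> f)"
      by (rule monom_of_cong) auto
    then show "Poly_Mapping.lookup (monom_of k B (restrict (\<sigma> \<circ> f) B)) i = Poly_Mapping.lookup y i"
      unfolding that(2) that(1)[symmetric] monom_of_def by (simp add: lookup_sum_single fin \<sigma>_eq)
  qed
  have "bij_betw (\<lambda>f. restrict (\<sigma> \<circ> f) B) (colourings k B a) (colourings k B a')"
  proof (rule bij_betw_byWitness[where f' = "\<lambda>f. restrict (\<sigma> \<circ> f) B"])
    show "\<forall>f\<in>colourings k B a. restrict (\<sigma> \<circ> restrict (\<sigma> \<circ> f) B) B = f"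
      by (auto simp: colourings_def fun_eq_iff \<sigma>\<sigma> PiE_def extensional_def)
    show "\<forall>f\<in>colourings k B a'. restrict (\<sigma> \<circ> restrict (\<sigma> \<circ> f) B) B = f"
      by (auto simp: colourings_def fun_eq_iff \<sigma>\<sigma> PiE_def extensional_def)
    show "(\<lambda>f. restrict (\<sigma> \<circ> f) B) ` colourings k B a \<subseteq> colourings k B a'"
      using step[OF _ look] by (auto simp: colourings_def)
    show "(\<lambda>f. restrict (\<sigma> \<circ> f) B) ` colourings k B a' \<subseteq> colourings k B a"
      using step[OF _ look'] by (auto simp: colourings_def)
  qed
  then show "mfps_coeff (power_prod k B) a' = mfps_coeff (power_prod k B) a"
    using mfps_coeff_prod_power_sum[where k = k, OF fin pos] by (simp add: bij_betw_same_card)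
qed

section \<open>Coefficients of symmetric series depend only on the monomial type\<close>

definition list_monom :: "nat list \<Rightarrow> nat \<Rightarrow>\<^sub>0 nat" where
  "list_monom xs = (\<Sum>i<length xs. Poly_Mapping.single i (xs ! i))"

lemma lookup_list_monom:
  "Poly_Mapping.lookup (list_monom xs) i = (if i < length xs then xs ! i else 0)"
proof -
  have "{j \<in> {..<length xs}. j = i} = (if i < length xs then {i} else {})" by auto
  then show ?thesis unfolding list_monom_def
    by (subst lookup_sum_single[of _ "\<lambda>i. i"]) auto
qed

lemma adj_sym_list_swap:
  assumes "adj_sym f"
  shows "mfps_coeff f (list_monom (us @ x # y # vs)) = mfps_coeff f (list_monom (us @ y # x # vs))"
proof -
  have "Poly_Mapping.lookup (list_monom (us @ x # y # vs)) =
    (Poly_Mapping.lookup (list_monom (us @ y # x # vs)))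
      (length us := Poly_Mapping.lookup (list_monom (us @ y # x # vs)) (Suc (length us)),
       Suc (length us) := Poly_Mapping.lookup (list_monom (us @ y # x # vs)) (length us))"
    by (auto simp: lookup_list_monom fun_eq_iff nth_append nth_Cons split: nat.splits)
  then show ?thesis using assms unfolding adj_sym_def by blast
qed

text \<open>Insertion sort consists of adjacent swaps. The prefix \<open>us\<close> allows swaps at
  any position.\<close>

lemma adj_sym_list_sort:
  assumes f: "adj_sym f"
  shows "mfps_coeff f (list_monom (us @ sort xs)) = mfps_coeff f (list_monom (us @ xs))"
proof -
  have insort: "mfps_coeff f (list_monom (us @ insort x xs)) = mfps_coeff f (list_monom (us @ x # xs))"
    for us x xs
  proof (induction xs arbitrary: us)
    case (Cons y ys)
    then show ?case
      using Cons.IH[of "us @ [y]"] adj_sym_list_swap[OF f, of us x y ys] by auto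
  qed simp
  show ?thesis
  proof (induction xs arbitrary: us)
    case (Cons x xs)
    then show ?case using insort[of us x "sort xs"] Cons.IH[of "us @ [x]"] by simp
  qed simp
qed

text \<open>As exponent lists of a common length \<open>N\<close>, padded with zeros, both monomials
  have the same multiset of entries and hence the same sorted list.\<close>

lemma adj_sym_mtype:
  assumes f: "adj_sym f" and eq: "mtype a = mtype b"
  shows "mfps_coeff f a = mfps_coeff f b"
proof -
  obtain N where N: "Poly_Mapping.keys a \<union> Poly_Mapping.keys b \<subseteq> {..<N}"
    using finite_nat_iff_bounded[of "Poly_Mapping.keys a \<union> Poly_Mapping.keys b"] by auto
  define ls where "ls c = map (Poly_Mapping.lookup c) [0..<N]" for c :: "nat \<Rightarrow>\<^sub>0 nat"
  have monom_ls: "list_monom (ls c) = c" if "Poly_Mapping.keys c \<subseteq> {..<N}" for c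
    using that by (intro poly_mapping_eqI) (auto simp: lookup_list_monom ls_def in_keys_iff)
  define M where "M c = image_mset (Poly_Mapping.lookup c) (mset_set (Poly_Mapping.keys c))"
    for c :: "nat \<Rightarrow>\<^sub>0 nat"
  have mset_ls: "mset (ls c) = M c + replicate_mset (N - size (M c)) 0"
    if "Poly_Mapping.keys c \<subseteq> {..<N}" for c
  proof -
    have "mset_set {..<N} = mset_set (Poly_Mapping.keys c) + mset_set ({..<N} - Poly_Mapping.keys c)"
      using that by (subst mset_set_Union[symmetric]) (auto intro!: arg_cong[of _ _ mset_set])
    moreover have "image_mset (Poly_Mapping.lookup c) (mset_set ({..<N} - Poly_Mapping.keys c)) =
        image_mset (\<lambda>_. 0) (mset_set ({..<N} - Poly_Mapping.keys c))"
      by (rule image_mset_cong) (auto simp: in_keys_iff)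
    ultimately show ?thesis
      using that unfolding ls_def M_def
      by (simp add: atLeast0LessThan image_mset_const_eq card_Diff_subset)
  qed
  have "count (M c) i = Poly_Mapping.lookup (mtype c) i" for c i
  proof -
    have "finite A \<Longrightarrow> count (image_mset h (mset_set A)) i = card {x \<in> A. h x = i}"
      for A :: "nat set" and h :: "nat \<Rightarrow> nat"
    proof (induction A rule: finite_induct)
      case (insert x A)
      have "{y \<in> insert x A. h y = i} = (if h x = i then insert x {y \<in> A. h y = i} else {y \<in> A. h y = i})"
        by auto
      then show ?case using insert by simp
    qed simp
    then show ?thesis by (simp add: M_def lookup_mtype)
  qed
  then have "M a = M b" using eq by (intro multiset_eqI) simp
  then have "mset (ls a) = mset (ls b)" using mset_ls N by simp
  then have "sort (ls a) = sort (ls b)" by (metis properties_for_sort sorted_sort mset_sort)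
  then show ?thesis
    using adj_sym_list_sort[OF f, of "[]" "ls a"] adj_sym_list_sort[OF f, of "[]" "ls b"]
      monom_ls[of a] monom_ls[of b] N by simp
qed

section \<open>Expansion in power sums\<close>

lemma poly_subst_superset:
  assumes "finite S" "Poly_Mapping.keys q \<subseteq> S" "\<iota> 0 = 0"
  shows "poly_subst \<iota> a q = (\<Sum>m\<in>S. \<iota> (Poly_Mapping.lookup q m) * (\<Prod>b\<in>parts m. a (fst b)))"
  unfolding poly_subst_def prod_parts using assms
  by (intro sum.mono_neutral_left) (auto simp: in_keys_iff)

lemma mfps_const_zero [simp]: "mfps_const 0 = 0"
  by (rule mfps_eqI) (simp add: mfps_const_def)

lemma mfps_coeff_poly_subst:
  assumes "finite S" "Poly_Mapping.keys q \<subseteq> S"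
  shows "mfps_coeff (poly_subst mfps_const power_sum q) a =
    (\<Sum>m\<in>S. Poly_Mapping.lookup q m * mfps_coeff (power_prod fst (parts m)) a)"
  by (simp add: poly_subst_superset[OF assms] mfps_coeff_sum)

lemma poly_subst_add:
  "poly_subst mfps_const power_sum (p + q) =
    poly_subst mfps_const power_sum p + poly_subst mfps_const power_sum q"
proof (rule mfps_eqI)
  fix a
  let ?S = "Poly_Mapping.keys p \<union> Poly_Mapping.keys q"
  have "mfps_coeff (poly_subst mfps_const power_sum (p + q)) a =
      (\<Sum>m\<in>?S. Poly_Mapping.lookup (p + q) m * mfps_coeff (power_prod fst (parts m)) a)"
    by (rule mfps_coeff_poly_subst) (use Poly_Mapping.keys_add[of p q] in auto)
  then show "mfps_coeff (poly_subst mfps_const power_sum (p + q)) a =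
      mfps_coeff (poly_subst mfps_const power_sum p + poly_subst mfps_const power_sum q) a"
    by (simp add: mfps_coeff_poly_subst[of ?S p] mfps_coeff_poly_subst[of ?S q] lookup_add
        distrib_right sum.distrib)
qed

text \<open>Give every part its own variable.\<close>

lemma ex_monom_of_type:
  assumes "0 \<notin> Poly_Mapping.keys \<mu>"
  obtains a where "mtype a = \<mu>" "mfps_coeff (power_prod fst (parts \<mu>)) a \<noteq> 0"
    "card (Poly_Mapping.keys a) = mdeg \<mu>" "mdeg a = wt id \<mu>"
proof -
  obtain f :: "nat \<times> nat \<Rightarrow> nat" where f: "inj_on f (parts \<mu>)"
    using finite_imp_inj_to_nat_seg[OF finite_parts[of \<mu>]] by metis
  have pos: "fst b > 0" if "b \<in> parts \<mu>" for b using fst_parts_pos[OF assms that] .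
  have props: "Poly_Mapping.keys (monom_of fst (parts \<mu>) f) = f ` parts \<mu>"
    "mdeg (monom_of fst (parts \<mu>) f) = sum fst (parts \<mu>)"
    "mtype (monom_of fst (parts \<mu>) f) = (\<Sum>b\<in>parts \<mu>. Poly_Mapping.single (fst b) 1)"
    using monom_of_props[of "parts \<mu>" fst f] pos f by auto
  show ?thesis
  proof (rule that[of "monom_of fst (parts \<mu>) f"])
    show "mtype (monom_of fst (parts \<mu>) f) = \<mu>"
      using props(3) sum_single_parts by simp
    show "mfps_coeff (power_prod fst (parts \<mu>)) (monom_of fst (parts \<mu>) f) \<noteq> 0"
      by (rule mfps_coeff_power_prod_monom_of) (use pos in auto)
    show "card (Poly_Mapping.keys (monom_of fst (parts \<mu>) f)) = mdeg \<mu>"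
      unfolding props(1) card_image[OF f] card_parts ..
    show "mdeg (monom_of fst (parts \<mu>) f) = wt id \<mu>"
      using props(2) sum_parts[of id \<mu>] by simp
  qed
qed

lemma mfps_coeff_power_prod_parts_nonzero:
  assumes "0 \<notin> Poly_Mapping.keys \<mu>" "mfps_coeff (power_prod fst (parts \<mu>)) a \<noteq> 0"
  shows "mdeg a = wt id \<mu>" "card (Poly_Mapping.keys a) \<le> mdeg \<mu>"
    "card (Poly_Mapping.keys a) = mdeg \<mu> \<Longrightarrow> mtype a = \<mu>"
  using mfps_coeff_power_prod_nonzero[of "parts \<mu>" fst a] fst_parts_pos[OF assms(1)] assms(2)
    sum_parts[of id \<mu>] card_parts[of \<mu>] sum_single_parts[of \<mu>]
  by (auto simp only: finite_parts id_apply)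

text \<open>
  Triangularity: among the keys of wrong weight, one with the largest number of parts is the only
  one contributing to the coefficient of a monomial of its type.
\<close>

lemma power_sum_expansion_homogeneous:
  assumes pos: "\<And>m. m \<in> Poly_Mapping.keys q \<Longrightarrow> 0 \<notin> Poly_Mapping.keys m"
    and hom: "\<And>a. mfps_coeff (poly_subst mfps_const power_sum q) a \<noteq> 0 \<Longrightarrow> mdeg a = n"
    and \<mu>: "\<mu> \<in> Poly_Mapping.keys q"
  shows "wt id \<mu> = n"
proof (rule ccontr)
  assume ne: "wt id \<mu> \<noteq> n"
  let ?off = "{m \<in> Poly_Mapping.keys q. wt id m \<noteq> n}"
  have fin: "finite ?off" and nonempty: "?off \<noteq> {}" using \<mu> ne by auto
  have "Max (mdeg ` ?off) \<in> mdeg ` ?off" by (rule Max_in) (use fin nonempty in blast)+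
  then obtain \<nu> where \<nu>: "\<nu> \<in> ?off" and Max: "Max (mdeg ` ?off) = mdeg \<nu>" by blast
  have max: "mdeg m \<le> mdeg \<nu>" if "m \<in> ?off" for m
    unfolding Max[symmetric] by (rule Max_ge) (use fin that in blast)+
  obtain a where a: "mtype a = \<nu>" "mfps_coeff (power_prod fst (parts \<nu>)) a \<noteq> 0"
    "card (Poly_Mapping.keys a) = mdeg \<nu>" "mdeg a = wt id \<nu>"
    using ex_monom_of_type[of \<nu>] pos \<nu> by blast
  have "mfps_coeff (poly_subst mfps_const power_sum q) a =
      (\<Sum>m\<in>Poly_Mapping.keys q. Poly_Mapping.lookup q m * mfps_coeff (power_prod fst (parts m)) a)"
    by (rule mfps_coeff_poly_subst) auto
  also have "\<dots> = (\<Sum>m\<in>{\<nu>}. Poly_Mapping.lookup q m * mfps_coeff (power_prod fst (parts m)) a)"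
  proof (rule sum.mono_neutral_right)
    show "\<forall>m\<in>Poly_Mapping.keys q - {\<nu>}. Poly_Mapping.lookup q m * mfps_coeff (power_prod fst (parts m)) a = 0"
    proof
      fix m assume m: "m \<in> Poly_Mapping.keys q - {\<nu>}"
      have "mfps_coeff (power_prod fst (parts m)) a = 0"
      proof (rule ccontr)
        assume nz: "mfps_coeff (power_prod fst (parts m)) a \<noteq> 0"
        have "0 \<notin> Poly_Mapping.keys m" using m pos by auto
        note P = mfps_coeff_power_prod_parts_nonzero[OF this nz]
        \<comment> \<open>\<open>m\<close> has the same weight as \<open>\<nu>\<close>, so
          maximality of \<open>\<nu>\<close> applies to it; together with the bound on variables
          this gives equally many parts, hence equal types.\<close>
        have "m \<in> ?off" using m P(1) a(4) \<nu> by auto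
        then have "card (Poly_Mapping.keys a) = mdeg m" using max P(2) a(3) by fastforce
        then have "m = \<nu>" using P(3) a(1) by simp
        then show False using m by simp
      qed
      then show "Poly_Mapping.lookup q m * mfps_coeff (power_prod fst (parts m)) a = 0" by simp
    qed
  qed (use \<nu> in auto)
  also have "\<dots> \<noteq> 0" using a(2) \<nu> by (simp add: in_keys_iff)
  finally have "mdeg a = n" using hom by blast
  then show False using a(4) \<nu> by simp
qed

lemma finite_types: "finite {\<mu>. 0 \<notin> Poly_Mapping.keys \<mu> \<and> wt id \<mu> = n}"
proof (rule finite_subset)
  \<comment> \<open>Every multiplicity function of size \<open>n\<close> is a summand of the
    exponent vector with \<open>n\<close> at each index up to \<open>n\<close>, and
    \<open>mon_splits\<close> is finite.\<close>
  let ?M = "\<Sum>i\<in>{..n}. Poly_Mapping.single i n"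
  show "finite (fst ` mon_splits ?M)" by simp
  show "{\<mu>. 0 \<notin> Poly_Mapping.keys \<mu> \<and> wt id \<mu> = n} \<subseteq> fst ` mon_splits ?M"
  proof
    fix \<mu> assume "\<mu> \<in> {\<mu>. 0 \<notin> Poly_Mapping.keys \<mu> \<and> wt id \<mu> = n}"
    then have \<mu>: "0 \<notin> Poly_Mapping.keys \<mu>" "wt id \<mu> = n" by auto
    have lookM: "Poly_Mapping.lookup ?M i = (if i \<le> n then n else 0)" for i
    proof -
      have "{b \<in> {..n}. b = i} = (if i \<le> n then {i} else {})" by auto
      then show ?thesis by (subst lookup_sum_single[of _ "\<lambda>i. i"]) auto
    qed
    have le: "Poly_Mapping.lookup \<mu> i \<le> Poly_Mapping.lookup ?M i" for i
    proof (cases "i \<in> Poly_Mapping.keys \<mu>")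
      case True
      then have pos: "i > 0" "Poly_Mapping.lookup \<mu> i > 0"
        using \<mu>(1) by (metis gr0I, simp add: in_keys_iff)
      have "Poly_Mapping.lookup \<mu> i * id i \<le> n"
        unfolding \<mu>(2)[symmetric] wt_def by (rule member_le_sum[OF True]) auto
      then have "Poly_Mapping.lookup \<mu> i \<le> n" "i \<le> n"
        using pos by (metis Suc_leI id_apply le_trans mult_le_mono2 nat_mult_1_right One_nat_def,
          metis Suc_leI id_apply le_trans mult_le_mono1 nat_mult_1 One_nat_def)
      then show ?thesis by (simp add: lookM)
    qed (simp add: in_keys_iff)
    have "\<mu> + (?M - \<mu>) = ?M"
      by (rule poly_mapping_eqI) (simp add: lookup_add lookup_minus le)
    then show "\<mu> \<in> fst ` mon_splits ?M"
      unfolding mon_splits_def by force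
  qed
qed

text \<open>Induction on a bound for the number of variables in a monomial of \<open>f\<close>.
  Subtracting products of exactly \<open>L\<close> power sums removes all monomials in
  \<open>L\<close> variables: such a product has no monomial in more variables, and among those in
  \<open>L\<close> variables only the ones of its own type.\<close>

lemma symmetric_imp_power_sum_poly:
  assumes "adj_sym f" "\<And>a. mfps_coeff f a \<noteq> 0 \<Longrightarrow> mdeg a = n"
    "\<And>a. L \<le> card (Poly_Mapping.keys a) \<Longrightarrow> mfps_coeff f a = 0"
  shows "\<exists>q. (\<forall>m\<in>Poly_Mapping.keys q. 0 \<notin> Poly_Mapping.keys m) \<and>
    f = poly_subst mfps_const power_sum q"
  using assms
proof (induction L arbitrary: f)
  case 0
  then have "f = poly_subst mfps_const power_sum 0"
    by (intro mfps_eqI) (simp add: poly_subst_def)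
  then show ?case by (intro exI[of _ 0]) simp
next
  case (Suc L)
  define M where "M = {\<mu>. 0 \<notin> Poly_Mapping.keys \<mu> \<and> wt id \<mu> = n \<and> mdeg \<mu> = L}"
  have finM: "finite M" by (rule finite_subset[OF _ finite_types[of n]]) (auto simp: M_def)
  have "\<exists>a. mtype a = \<mu> \<and> mfps_coeff (power_prod fst (parts \<mu>)) a \<noteq> 0" if "\<mu> \<in> M" for \<mu>
    using ex_monom_of_type[of \<mu>] that unfolding M_def by blast
  then obtain rep where rep: "\<And>\<mu>. \<mu> \<in> M \<Longrightarrow> mtype (rep \<mu>) = \<mu>"
    "\<And>\<mu>. \<mu> \<in> M \<Longrightarrow> mfps_coeff (power_prod fst (parts \<mu>)) (rep \<mu>) \<noteq> 0" by metis
  \<comment> \<open>Chosen so that \<open>f\<close> and the subtracted combination agree at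
    \<open>rep \<mu>\<close>; by symmetry they then agree at every monomial of type
    \<open>\<mu>\<close>.\<close>
  define t where "t \<mu> = mfps_coeff f (rep \<mu>) / mfps_coeff (power_prod fst (parts \<mu>)) (rep \<mu>)" for \<mu>
  define q' where "q' = (\<Sum>\<mu>\<in>M. Poly_Mapping.single \<mu> (t \<mu>))"
  have look_q': "Poly_Mapping.lookup q' \<mu> = (if \<mu> \<in> M then t \<mu> else 0)" for \<mu>
    unfolding q'_def by (simp add: lookup_sum lookup_single when_def finM)
  have keys_q': "Poly_Mapping.keys q' \<subseteq> M"
    by (auto simp: in_keys_iff look_q' split: if_splits)
  have sub: "mfps_coeff (poly_subst mfps_const power_sum q') a =
      (\<Sum>\<mu>\<in>M. t \<mu> * mfps_coeff (power_prod fst (parts \<mu>)) a)" for a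
    unfolding mfps_coeff_poly_subst[OF finM keys_q'] by (simp add: look_q')
  let ?f = "f - poly_subst mfps_const power_sum q'"
  have symP: "adj_sym (power_prod fst (parts \<mu>))" if "\<mu> \<in> M" for \<mu>
    using that by (intro adj_sym_power_prod) (auto simp: M_def intro: fst_parts_pos[of \<mu>])
  have sym_f': "adj_sym ?f"
    unfolding adj_sym_def
  proof (intro allI impI)
    fix r and a a' :: "nat \<Rightarrow>\<^sub>0 nat"
    assume *: "Poly_Mapping.lookup a' =
      (Poly_Mapping.lookup a)(r := Poly_Mapping.lookup a (Suc r), Suc r := Poly_Mapping.lookup a r)"
    have "mfps_coeff f a' = mfps_coeff f a" using Suc.prems(1) * unfolding adj_sym_def by blast
    moreover have "mfps_coeff (power_prod fst (parts \<mu>)) a' = mfps_coeff (power_prod fst (parts \<mu>)) a"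
      if "\<mu> \<in> M" for \<mu> using symP[OF that] * unfolding adj_sym_def by blast
    ultimately show "mfps_coeff ?f a' = mfps_coeff ?f a" by (simp add: sub cong: sum.cong)
  qed
  have zero: "mfps_coeff (poly_subst mfps_const power_sum q') a = 0"
    if "\<And>\<mu>. \<mu> \<in> M \<Longrightarrow> mfps_coeff (power_prod fst (parts \<mu>)) a = 0" for a
    unfolding sub by (rule sum.neutral) (use that in auto)
  note nz = mfps_coeff_power_prod_parts_nonzero
  have hom_f': "mdeg a = n" if "mfps_coeff ?f a \<noteq> 0" for a
  proof (rule ccontr)
    assume ne: "mdeg a \<noteq> n"
    have "mfps_coeff (poly_subst mfps_const power_sum q') a = 0"
      by (rule zero) (use nz(1) ne in \<open>auto simp: M_def\<close>)
    then show False using Suc.prems(2)[of a] ne that by auto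
  qed
  have small_f': "mfps_coeff ?f a = 0" if L: "L \<le> card (Poly_Mapping.keys a)" for a
  proof (cases "L = card (Poly_Mapping.keys a)")
    case False
    then have lt: "L < card (Poly_Mapping.keys a)" using L by simp
    have "mfps_coeff (poly_subst mfps_const power_sum q') a = 0"
      by (rule zero) (use nz(2)[of _ a] lt in \<open>fastforce simp: M_def\<close>)
    then show ?thesis using Suc.prems(3)[of a] lt by auto
  next
    case card: True
    show ?thesis
    proof (cases "mdeg a = n")
      case False
      then show ?thesis using hom_f' by blast
    next
      case True
      let ?\<mu> = "mtype a"
      have "wt id ?\<mu> = n" unfolding wt_mtype using True by (simp add: wt_def)
      moreover have "mdeg ?\<mu> = L" using card by (simp add: wt_mtype)
      ultimately have inM: "?\<mu> \<in> M" using zero_notin_keys_mtype by (simp add: M_def)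
      have "mfps_coeff (poly_subst mfps_const power_sum q') a =
          (\<Sum>\<mu>\<in>{?\<mu>}. t \<mu> * mfps_coeff (power_prod fst (parts \<mu>)) a)"
        unfolding sub
      proof (rule sum.mono_neutral_right[OF finM])
        show "\<forall>\<mu>\<in>M - {?\<mu>}. t \<mu> * mfps_coeff (power_prod fst (parts \<mu>)) a = 0"
          using nz(3)[of _ a] card by (fastforce simp: M_def)
      qed (use inM in auto)
      also have "\<dots> = t ?\<mu> * mfps_coeff (power_prod fst (parts ?\<mu>)) a" by simp
      also have "mfps_coeff (power_prod fst (parts ?\<mu>)) a = mfps_coeff (power_prod fst (parts ?\<mu>)) (rep ?\<mu>)"
        by (rule adj_sym_mtype[OF symP[OF inM]]) (simp add: rep(1)[OF inM])
      also have "t ?\<mu> * \<dots> = mfps_coeff f (rep ?\<mu>)"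
        using rep(2)[OF inM] by (simp add: t_def)
      also have "\<dots> = mfps_coeff f a"
        by (rule adj_sym_mtype[OF Suc.prems(1)]) (simp add: rep(1)[OF inM])
      finally show ?thesis by simp
    qed
  qed
  obtain q where q: "\<forall>m\<in>Poly_Mapping.keys q. 0 \<notin> Poly_Mapping.keys m"
    "?f = poly_subst mfps_const power_sum q"
    using Suc.IH[OF sym_f' hom_f' small_f'] by blast
  have "f = poly_subst mfps_const power_sum (q + q')"
    unfolding poly_subst_add q(2)[symmetric] by simp
  moreover have "\<forall>m\<in>Poly_Mapping.keys (q + q'). 0 \<notin> Poly_Mapping.keys m"
    using q(1) keys_q' Poly_Mapping.keys_add[of q q'] by (auto simp: M_def)
  ultimately show ?case by blast
qed

section \<open>Umbral evaluation\<close>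

lemma umbral_bound: "degree P \<le> N \<Longrightarrow> umbral P = (\<Sum>k\<le>N. coeff P k * euler_number k)"
  unfolding umbral_def by (rule sum.mono_neutral_left) (auto simp: coeff_eq_0)

lemma umbral_zero [simp]: "umbral 0 = 0"
  by (simp add: umbral_def)

lemma umbral_add: "umbral (P + Q) = umbral P + umbral Q"
proof -
  let ?N = "max (degree P) (degree Q)"
  have "umbral (P + Q) = (\<Sum>k\<le>?N. coeff (P + Q) k * euler_number k)"
    by (rule umbral_bound) (rule degree_add_le_max)
  then show ?thesis
    by (simp add: umbral_bound[of P ?N] umbral_bound[of Q ?N] distrib_right sum.distrib)
qed

lemma umbral_sum: "umbral (sum f A) = (\<Sum>x\<in>A. umbral (f x))"
  by (induction A rule: infinite_finite_induct) (simp_all add: umbral_add)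

lemma umbral_const_mult: "umbral ([:c:] * P) = c * umbral P"
  using umbral_bound[of "[:c:] * P" "degree P"] degree_smult_le[of c P]
  by (simp add: umbral_def sum_distrib_left mult.assoc)

lemma umbral_monom: "umbral (monom c k) = c * euler_number k"
proof -
  have "umbral (monom c k) = (\<Sum>j\<le>k. coeff (monom c k) j * euler_number j)"
    by (rule umbral_bound) (rule degree_monom_le)
  also have "\<dots> = (\<Sum>j\<in>{k}. coeff (monom c k) j * euler_number j)"
    by (rule sum.mono_neutral_right) auto
  finally show ?thesis by simp
qed

text \<open>The three substitutions as one family in \<open>u\<close>, written with
  \<open>monom\<close> so that products stay monomials in E whose exponent counts the odd
  parts.\<close>

definition signed_subst :: "rat \<Rightarrow> nat \<Rightarrow> rat poly" where
  "signed_subst u i = (if odd i then monom ((-1) ^ (i div 2)) 1 else monom (u * (-1) ^ (i div 2)) 0)"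

lemma minus_one_power_poly: "(-1 :: rat poly) ^ j = [:(-1) ^ j:]"
  by (induction j) (simp_all add: one_pCons)

lemma subst_eq_signed_subst:
  "subst_odd = signed_subst 0" "subst_even_alt = signed_subst 1" "subst_even_ralt = signed_subst (-1)"
  by (auto simp: subst_odd_def subst_even_alt_def subst_even_ralt_def signed_subst_def fun_eq_iff
      minus_one_power_poly monom_altdef)

lemma prod_signed_subst:
  assumes "finite B"
  shows "(\<Prod>b\<in>B. signed_subst u (k b)) =
    monom (part_sign k B * u ^ card (evens k B)) (card (odds k B))"
  using assms
proof (induction B rule: finite_induct)
  case empty
  then show ?case by (simp add: part_sign_def evens_def odds_def)
next
  case (insert x B)
  have fin: "finite (evens k B)" "finite (odds k B)" "x \<notin> evens k B" "x \<notin> odds k B"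
    using insert by (auto simp: evens_def odds_def)
  have part_sign: "part_sign k (insert x B) = (-1) ^ (k x div 2) * part_sign k B"
    using insert by (simp add: part_sign_def)
  show ?case
  proof (cases "even (k x)")
    case True
    then have "evens k (insert x B) = insert x (evens k B)" "odds k (insert x B) = odds k B"
      by (auto simp: evens_def odds_def)
    then show ?thesis using insert fin True
      by (simp add: part_sign signed_subst_def mult_monom mult_ac)
  next
    case False
    then have "evens k (insert x B) = evens k B" "odds k (insert x B) = insert x (odds k B)"
      by (auto simp: evens_def odds_def)
    then show ?thesis using insert fin False
      by (simp add: part_sign signed_subst_def mult_monom mult_ac)
  qed
qed

lemma umbral_prod_signed_subst:
  "finite B \<Longrightarrow> umbral (\<Prod>b\<in>B. signed_subst u (k b)) =
    part_sign k B * u ^ card (evens k B) * euler_number (card (odds k B))"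
  by (simp add: prod_signed_subst umbral_monom)

lemma even_card_odds: "finite B \<Longrightarrow> even (card (odds k B)) \<longleftrightarrow> even (sum k B)"
  unfolding odds_def by (subst even_sum_iff) auto

text \<open>The number of odd parts has the parity of the degree, so the Euler number is a pure
  tangent or a pure secant number. The power of \<open>u\<close> given by the number of even parts
  matches the even-part factor of each closed form: the delta for 0, no factor for 1, the sign for
  -1.\<close>

lemma umbral_eq_alt_functional_power_prod:
  assumes fin: "finite B" and pos: "\<And>b. b \<in> B \<Longrightarrow> k b > 0"
  shows "odd (sum k B) \<Longrightarrow>
      umbral (\<Prod>b\<in>B. signed_subst 0 (k b)) = alt_functional c (sum k B) (power_prod k B)"
    and "even (sum k B) \<Longrightarrow>
      umbral (\<Prod>b\<in>B. signed_subst 1 (k b)) = alt_functional False (sum k B) (power_prod k B)"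
    and "even (sum k B) \<Longrightarrow>
      umbral (\<Prod>b\<in>B. signed_subst (-1) (k b)) = alt_functional True (sum k B) (power_prod k B)"
proof -
  assume odd: "odd (sum k B)"
  have "alt_functional c (sum k B) (power_prod k B) = tangent_val k B"
    using alt_functional_True_odd[of B k] alt_functional_False_odd[of B k] fin pos odd by (cases c) auto
  moreover have "secn (card (odds k B)) = 0" using odd even_card_odds[OF fin] by (simp add: secn_odd)
  ultimately show "umbral (\<Prod>b\<in>B. signed_subst 0 (k b)) = alt_functional c (sum k B) (power_prod k B)"
    by (simp add: umbral_prod_signed_subst fin euler_number_eq tangent_val_def power_0_left)
next
  assume even: "even (sum k B)"
  then have tan: "tann (card (odds k B)) = 0" using even_card_odds[OF fin] by (simp add: tann_even)
  show "umbral (\<Prod>b\<in>B. signed_subst 1 (k b)) = alt_functional False (sum k B) (power_prod k B)"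
    using alt_functional_False_even[of B k] fin pos even tan
    by (simp add: umbral_prod_signed_subst euler_number_eq)
  show "umbral (\<Prod>b\<in>B. signed_subst (-1) (k b)) = alt_functional True (sum k B) (power_prod k B)"
    using alt_functional_True_even[of B k] fin pos even tan
    by (simp add: umbral_prod_signed_subst euler_number_eq secant_val_def)
qed

lemma alt_functional_poly_subst:
  "alt_functional c n (poly_subst mfps_const power_sum q) =
    (\<Sum>\<mu>\<in>Poly_Mapping.keys q. Poly_Mapping.lookup q \<mu> * alt_functional c n (power_prod fst (parts \<mu>)))"
proof -
  have "alt_functional c n (poly_subst mfps_const power_sum q) =
    (\<Sum>S\<in>Pow (parity_set c n). \<Sum>\<mu>\<in>Poly_Mapping.keys q. Poly_Mapping.lookup q \<mu> *
      ((-1) ^ card (parity_set c n - S) * mfps_coeff (power_prod fst (parts \<mu>)) (comp_monom n S)))"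
    unfolding alt_functional_def
    by (simp add: mfps_coeff_poly_subst[of "Poly_Mapping.keys q"] sum_distrib_left mult_ac)
  then show ?thesis
    unfolding alt_functional_def by (subst (asm) sum.swap) (simp add: sum_distrib_left)
qed

lemma umbral_sym_subst:
  assumes sym: "adj_sym f" and hom: "\<And>a. mfps_coeff f a \<noteq> 0 \<Longrightarrow> mdeg a = n"
  shows "odd n \<Longrightarrow> umbral (sym_subst f subst_odd) = alt_functional c n f"
    and "even n \<Longrightarrow> umbral (sym_subst f subst_even_alt) = alt_functional False n f"
    and "even n \<Longrightarrow> umbral (sym_subst f subst_even_ralt) = alt_functional True n f"
proof -
  let ?q = "power_sum_expansion f"
  have "mfps_coeff f a = 0" if "Suc n \<le> card (Poly_Mapping.keys a)" for a
  proof (rule ccontr)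
    assume "mfps_coeff f a \<noteq> 0"
    then have "n = (\<Sum>i\<in>Poly_Mapping.keys a. Poly_Mapping.lookup a i)"
      using hom by (simp add: wt_def)
    also have "\<dots> \<ge> (\<Sum>i\<in>Poly_Mapping.keys a. 1)"
      by (rule sum_mono) (auto simp: in_keys_iff Suc_le_eq)
    finally show False using that by simp
  qed
  then have "\<exists>q. (\<forall>m\<in>Poly_Mapping.keys q. 0 \<notin> Poly_Mapping.keys m) \<and>
      f = poly_subst mfps_const power_sum q"
    using symmetric_imp_power_sum_poly[OF sym hom] by blast
  then have "(\<forall>m\<in>Poly_Mapping.keys ?q. 0 \<notin> Poly_Mapping.keys m) \<and>
      f = poly_subst mfps_const power_sum ?q"
    unfolding power_sum_expansion_def by (rule someI_ex)
  then have q: "\<And>m. m \<in> Poly_Mapping.keys ?q \<Longrightarrow> 0 \<notin> Poly_Mapping.keys m"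
    and f: "poly_subst mfps_const power_sum ?q = f" by auto
  \<comment> \<open>The closed forms concern products of degree \<open>n\<close>, so the weight of
    every monomial of the chosen expansion is needed.\<close>
  have deg: "sum fst (parts \<mu>) = n" if "\<mu> \<in> Poly_Mapping.keys ?q" for \<mu>
    using power_sum_expansion_homogeneous[of ?q n \<mu>] q hom that sum_parts[of id \<mu>]
    unfolding f by simp
  have main: "umbral (sym_subst f (signed_subst u)) = alt_functional c n f"
    if "\<And>\<mu>. \<mu> \<in> Poly_Mapping.keys ?q \<Longrightarrow>
      umbral (\<Prod>b\<in>parts \<mu>. signed_subst u (fst b)) =
      alt_functional c (sum fst (parts \<mu>)) (power_prod fst (parts \<mu>))" for u c
  proof -
    have "umbral (sym_subst f (signed_subst u)) = (\<Sum>\<mu>\<in>Poly_Mapping.keys ?q.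
        Poly_Mapping.lookup ?q \<mu> * umbral (\<Prod>b\<in>parts \<mu>. signed_subst u (fst b)))"
      unfolding sym_subst_def poly_subst_def prod_parts umbral_sum umbral_const_mult ..
    also have "\<dots> = (\<Sum>\<mu>\<in>Poly_Mapping.keys ?q.
        Poly_Mapping.lookup ?q \<mu> * alt_functional c n (power_prod fst (parts \<mu>)))"
      using that deg by (intro sum.cong) auto
    also have "\<dots> = alt_functional c n f"
      using alt_functional_poly_subst[of c n ?q] unfolding f by simp
    finally show ?thesis .
  qed
  have pos: "\<And>\<mu> b. \<mu> \<in> Poly_Mapping.keys ?q \<Longrightarrow> b \<in> parts \<mu> \<Longrightarrow> fst b > 0"
    using fst_parts_pos q by blast
  show "odd n \<Longrightarrow> umbral (sym_subst f subst_odd) = alt_functional c n f"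
    unfolding subst_eq_signed_subst
    by (rule main, rule umbral_eq_alt_functional_power_prod(1)) (use pos deg in auto)
  show "even n \<Longrightarrow> umbral (sym_subst f subst_even_alt) = alt_functional False n f"
    unfolding subst_eq_signed_subst
    by (rule main, rule umbral_eq_alt_functional_power_prod(2)) (use pos deg in auto)
  show "even n \<Longrightarrow> umbral (sym_subst f subst_even_ralt) = alt_functional True n f"
    unfolding subst_eq_signed_subst
    by (rule main, rule umbral_eq_alt_functional_power_prod(3)) (use pos deg in auto)
qed

section \<open>Symmetry of Schur functions\<close>

text \<open>Length 0 beyond the shape turns membership in \<open>cells lam\<close> into a single
  inequality.\<close>

definition row :: "nat list \<Rightarrow> nat \<Rightarrow> nat" where
  "row lam i = (if i < length lam then lam ! i else 0)"

lemma mem_cells [simp]: "(i, j) \<in> cells lam \<longleftrightarrow> j < row lam i"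
  by (auto simp: cells_def row_def)

lemma cells_eq_Sigma: "cells lam = Sigma {..<length lam} (\<lambda>i. {..<row lam i})"
  by (auto simp: cells_def row_def)

lemma finite_cells [simp]: "finite (cells lam)"
  by (simp add: cells_eq_Sigma)

lemma card_cells: "card (cells lam) = sum_list lam"
  by (simp add: cells_eq_Sigma card_SigmaI row_def sum_list_sum_nth atLeast0LessThan)

lemma row_antimono:
  assumes "is_partition_of lam n" "i \<le> i'"
  shows "row lam i' \<le> row lam i"
  using assms sorted_wrt_nth_less[of "(\<ge>)" lam i i']
  by (cases "i = i'") (auto simp: is_partition_of_def row_def)

lemma down_closed_nat:
  fixes D :: "nat set"
  assumes "finite D" "\<And>x y. x \<in> D \<Longrightarrow> y < x \<Longrightarrow> y \<in> D"
  shows "D = {..<card D}"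
proof (cases "D = {}")
  case False
  have "D = {..<Suc (Max D)}"
  proof (rule set_eqI)
    fix x
    show "x \<in> D \<longleftrightarrow> x \<in> {..<Suc (Max D)}"
      using assms(2)[OF Max_in[OF assms(1) False], of x] Max_in[OF assms(1) False]
        Max_ge[OF assms(1), of x]
      by (auto simp: less_Suc_eq_le le_less)
  qed
  then show ?thesis by (metis card_lessThan)
qed simp

text \<open>
  Gelfand-Tsetlin patterns: \<open>g k i\<close> is the number of entries smaller than \<open>k\<close> in row \<open>i\<close> of a
  semistandard tableau with content \<open>m\<close>.
\<close>

definition GT :: "nat list \<Rightarrow> (nat \<Rightarrow>\<^sub>0 nat) \<Rightarrow> (nat \<Rightarrow> nat \<Rightarrow> nat) set" where
  "GT lam m = {g. (\<forall>i. g 0 i = 0) \<and> (\<forall>k i. g k i \<le> g (Suc k) i) \<and>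
     (\<forall>k i. g (Suc k) (Suc i) \<le> g k i) \<and> (\<exists>K. \<forall>k\<ge>K. \<forall>i. g k i = row lam i) \<and>
     (\<forall>k. (\<Sum>i<length lam. g (Suc k) i) = (\<Sum>i<length lam. g k i) + Poly_Mapping.lookup m k)}"

definition SSYT_content :: "nat list \<Rightarrow> (nat \<Rightarrow>\<^sub>0 nat) \<Rightarrow> (nat \<times> nat \<Rightarrow> nat) set" where
  "SSYT_content lam m =
    {T \<in> SSYT lam. \<forall>k. card {c \<in> cells lam. T c = k} = Poly_Mapping.lookup m k}"

definition pattern_of :: "nat list \<Rightarrow> (nat \<times> nat \<Rightarrow> nat) \<Rightarrow> nat \<Rightarrow> nat \<Rightarrow> nat" where
  "pattern_of lam T k i = card {j. j < row lam i \<and> T (i, j) < k}"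

text \<open>In row \<open>i\<close> the entry \<open>k\<close> fills the columns from
  \<open>g k i\<close> up to, but excluding, \<open>g (Suc k) i\<close>.\<close>

definition tableau_of :: "nat list \<Rightarrow> (nat \<Rightarrow> nat \<Rightarrow> nat) \<Rightarrow> nat \<times> nat \<Rightarrow> nat" where
  "tableau_of lam g = restrict (\<lambda>(i, j). LEAST k. j < g (Suc k) i) (cells lam)"

text \<open>Rows increase weakly, so the cells with entries below \<open>k\<close> form an initial
  segment of the row. Pattern conditions thereby turn into comparisons of single entries.\<close>

lemma less_pattern_of:
  assumes "T \<in> SSYT lam"
  shows "j < pattern_of lam T k i \<longleftrightarrow> j < row lam i \<and> T (i, j) < k"
proof -
  let ?D = "{j. j < row lam i \<and> T (i, j) < k}"
  have "?D = {..<card ?D}"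
  proof (rule down_closed_nat)
    fix x y assume "x \<in> ?D" "y < x"
    moreover have "T (i, y) \<le> T (i, x)"
      using assms calculation by (simp add: SSYT_def)
    ultimately show "y \<in> ?D" by auto
  qed auto
  then have "j \<in> ?D \<longleftrightarrow> j \<in> {..<card ?D}" by simp
  then show ?thesis by (simp add: pattern_of_def)
qed

lemma sum_pattern_of:
  "(\<Sum>i<length lam. pattern_of lam T k i) = card {c \<in> cells lam. T c < k}"
proof -
  have "{c \<in> cells lam. T c < k} = Sigma {..<length lam} (\<lambda>i. {j. j < row lam i \<and> T (i, j) < k})"
    by (auto simp: cells_eq_Sigma)
  then show ?thesis by (simp add: pattern_of_def card_SigmaI)
qed

lemma content_iff_sums:
  "(\<forall>k. card {c \<in> cells lam. T c = k} = Poly_Mapping.lookup m k) \<longleftrightarrow>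
   (\<forall>k. (\<Sum>i<length lam. pattern_of lam T (Suc k) i) =
     (\<Sum>i<length lam. pattern_of lam T k i) + Poly_Mapping.lookup m k)"
proof -
  have "card {c \<in> cells lam. T c < Suc k} =
      card {c \<in> cells lam. T c < k} + card {c \<in> cells lam. T c = k}" for k
    by (subst card_Un_disjoint[symmetric]) (auto intro!: arg_cong[of _ _ card])
  then show ?thesis by (simp add: sum_pattern_of)
qed

lemma pattern_of_in_GT:
  assumes lam: "is_partition_of lam n" and T: "T \<in> SSYT_content lam m"
  shows "pattern_of lam T \<in> GT lam m"
proof -
  have T': "T \<in> SSYT lam" using T by (simp add: SSYT_content_def)
  note less = less_pattern_of[OF T']
  have le: "x \<le> y" if "\<And>j. j < x \<Longrightarrow> j < y" for x y :: nat
    using that[of y] by (meson not_le less_irrefl)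
  have "pattern_of lam T 0 i = 0" for i by (simp add: pattern_of_def)
  moreover have "pattern_of lam T k i \<le> pattern_of lam T (Suc k) i" for k i
    by (rule le) (auto simp: less)
  \<comment> \<open>Interlacing expresses column strictness: above an entry at most \<open>k\<close>
    stands an entry below \<open>k\<close>.\<close>
  moreover have "pattern_of lam T (Suc k) (Suc i) \<le> pattern_of lam T k i" for k i
  proof (rule le)
    fix j assume "j < pattern_of lam T (Suc k) (Suc i)"
    then have j: "j < row lam (Suc i)" "T (Suc i, j) < Suc k" by (auto simp: less)
    have "T (i, j) < T (Suc i, j)" using T' j(1) by (simp add: SSYT_def)
    moreover have "j < row lam i" using row_antimono[OF lam, of i "Suc i"] j(1) by simp
    ultimately show "j < pattern_of lam T k i" using j by (simp add: less)
  qed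
  moreover have "\<forall>k\<ge>Suc (Max (insert 0 (T ` cells lam))). \<forall>i. pattern_of lam T k i = row lam i"
  proof (intro allI impI)
    fix k i assume k: "Suc (Max (insert 0 (T ` cells lam))) \<le> k"
    have "T (i, j) < k" if "j < row lam i" for j
    proof -
      have "T (i, j) \<in> insert 0 (T ` cells lam)" using that by (auto intro!: imageI)
      then have "T (i, j) \<le> Max (insert 0 (T ` cells lam))" by (intro Max_ge) auto
      then show ?thesis using k by simp
    qed
    then have "{j. j < row lam i \<and> T (i, j) < k} = {..<row lam i}" by auto
    then show "pattern_of lam T k i = row lam i" by (simp add: pattern_of_def)
  qed
  moreover have "\<forall>k. (\<Sum>i<length lam. pattern_of lam T (Suc k) i) =
      (\<Sum>i<length lam. pattern_of lam T k i) + Poly_Mapping.lookup m k"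
    using T content_iff_sums[of lam T m] by (simp add: SSYT_content_def)
  ultimately show ?thesis unfolding GT_def by blast
qed

lemma GT_mono:
  assumes "g \<in> GT lam m"
  shows "k \<le> k' \<Longrightarrow> g k i \<le> g k' i" and "i \<le> i' \<Longrightarrow> g k i' \<le> g k i" and "g k i \<le> row lam i"
proof -
  have mono: "g k i \<le> g k' i" if "k \<le> k'" for k k' i
    using assms by (intro lift_Suc_mono_le[of "\<lambda>k. g k i", OF _ that]) (auto simp: GT_def)
  then show "k \<le> k' \<Longrightarrow> g k i \<le> g k' i" .
  have "g k (Suc i) \<le> g k i" for i
    using assms le_trans[of "g k (Suc i)" "g (Suc k) (Suc i)" "g k i"] by (auto simp: GT_def)
  then show "i \<le> i' \<Longrightarrow> g k i' \<le> g k i" by (rule lift_Suc_antimono_le)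
  obtain K where K: "\<forall>k\<ge>K. \<forall>i. g k i = row lam i" using assms by (auto simp: GT_def)
  have "g k i \<le> g (max k K) i" by (rule mono) simp
  then show "g k i \<le> row lam i" using K by simp
qed

text \<open>The counterpart of \<open>less_pattern_of\<close>; together they make the two
  constructions mutually inverse.\<close>

lemma tableau_of_less:
  assumes g: "g \<in> GT lam m" and j: "j < row lam i"
  shows "tableau_of lam g (i, j) < k \<longleftrightarrow> j < g k i"
proof -
  obtain K where "\<forall>k\<ge>K. \<forall>i. g k i = row lam i" using g by (auto simp: GT_def)
  then have "j < g (Suc K) i" using j by simp
  then have least: "j < g (Suc (LEAST k. j < g (Suc k) i)) i" by (rule LeastI)
  have T: "tableau_of lam g (i, j) = (LEAST k. j < g (Suc k) i)"
    using j by (simp add: tableau_of_def)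
  show ?thesis
  proof
    assume "tableau_of lam g (i, j) < k"
    then have "g (Suc (LEAST k. j < g (Suc k) i)) i \<le> g k i"
      unfolding T by (intro GT_mono(1)[OF g]) simp
    then show "j < g k i" using least by simp
  next
    assume jk: "j < g k i"
    then have "k \<noteq> 0" using g by (auto simp: GT_def intro: gr0I)
    then obtain k' where k': "k = Suc k'" by (cases k) auto
    have "(LEAST k. j < g (Suc k) i) \<le> k'" using jk k' by (intro Least_le) simp
    then show "tableau_of lam g (i, j) < k" unfolding T k' by simp
  qed
qed

lemma pattern_of_tableau_of:
  assumes g: "g \<in> GT lam m"
  shows "pattern_of lam (tableau_of lam g) = g"
proof (intro ext)
  fix k i
  have "{j. j < row lam i \<and> tableau_of lam g (i, j) < k} = {..<g k i}"
    using tableau_of_less[OF g, of _ i k] GT_mono(3)[OF g, of k i] by auto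
  then show "pattern_of lam (tableau_of lam g) k i = g k i" by (simp add: pattern_of_def)
qed

lemma tableau_of_in_SSYT_content:
  assumes lam: "is_partition_of lam n" and g: "g \<in> GT lam m"
  shows "tableau_of lam g \<in> SSYT_content lam m"
proof -
  let ?T = "tableau_of lam g"
  have "?T (i, j) \<le> ?T (i, j')" if "j < j'" "j' < row lam i" for i j j'
    using tableau_of_less[OF g, of j' i "Suc (?T (i, j'))"]
      tableau_of_less[OF g, of j i "Suc (?T (i, j'))"] that by simp
  moreover have "?T (i, j) < ?T (i', j)" if "i < i'" "j < row lam i'" for i i' j
  proof -
    obtain l where l: "i' = Suc l" "i \<le> l" using \<open>i < i'\<close> by (cases i') auto
    have "j < g (Suc (?T (i', j))) i'" using tableau_of_less[OF g that(2)] by blast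
    also have "\<dots> \<le> g (?T (i', j)) l" using g l by (simp add: GT_def)
    also have "\<dots> \<le> g (?T (i', j)) i" using l by (intro GT_mono(2)[OF g])
    finally show ?thesis
      using tableau_of_less[OF g, of j i] row_antimono[OF lam, of i i'] that by simp
  qed
  ultimately have "?T \<in> SSYT lam" by (simp add: SSYT_def tableau_of_def)
  then show ?thesis
    using g content_iff_sums[of lam ?T m] unfolding pattern_of_tableau_of[OF g]
    by (simp add: SSYT_content_def GT_def)
qed

lemma tableau_of_pattern_of:
  assumes lam: "is_partition_of lam n" and T: "T \<in> SSYT_content lam m"
  shows "tableau_of lam (pattern_of lam T) = T"
proof
  fix c :: "nat \<times> nat"
  obtain i j where c: "c = (i, j)" by (cases c)
  have T': "T \<in> SSYT lam" using T by (simp add: SSYT_content_def)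
  show "tableau_of lam (pattern_of lam T) c = T c"
  proof (cases "j < row lam i")
    case True
    have "tableau_of lam (pattern_of lam T) (i, j) < k \<longleftrightarrow> T (i, j) < k" for k
      using tableau_of_less[OF pattern_of_in_GT[OF lam T] True, of k] less_pattern_of[OF T'] True
      by simp
    then show ?thesis unfolding c by (metis linorder_neqE_nat less_irrefl)
  next
    case False
    then show ?thesis using T' by (simp add: c tableau_of_def SSYT_def extensional_def)
  qed
qed

lemma bij_betw_pattern_of:
  assumes "is_partition_of lam n"
  shows "bij_betw (pattern_of lam) (SSYT_content lam m) (GT lam m)"
  by (rule bij_betw_byWitness[where f' = "tableau_of lam"])
     (use assms tableau_of_pattern_of pattern_of_tableau_of pattern_of_in_GT
        tableau_of_in_SSYT_content in auto)

text \<open>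
  The rows \<open>r\<close> and \<open>r + 2\<close> of a pattern confine each entry of row \<open>r + 1\<close> to an interval
  \<open>{flip_lo..flip_hi}\<close>, independently of each other. Reflecting all of them in their intervals is
  the Bender-Knuth involution.
\<close>

definition flip_lo :: "nat \<Rightarrow> (nat \<Rightarrow> nat \<Rightarrow> nat) \<Rightarrow> nat \<Rightarrow> nat" where
  "flip_lo r g i = max (g r i) (g (Suc (Suc r)) (Suc i))"

definition flip_hi :: "nat \<Rightarrow> (nat \<Rightarrow> nat \<Rightarrow> nat) \<Rightarrow> nat \<Rightarrow> nat" where
  "flip_hi r g i = (if i = 0 then g (Suc (Suc r)) 0 else min (g (Suc (Suc r)) i) (g r (i - 1)))"

definition flip :: "nat \<Rightarrow> (nat \<Rightarrow> nat \<Rightarrow> nat) \<Rightarrow> nat \<Rightarrow> nat \<Rightarrow> nat" where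
  "flip r g = g(Suc r := \<lambda>i. flip_lo r g i + flip_hi r g i - g (Suc r) i)"

lemma flip_bounds:
  assumes "g \<in> GT lam m"
  shows "flip_lo r g i \<le> g (Suc r) i" "g (Suc r) i \<le> flip_hi r g i"
  using assms by (auto simp: GT_def flip_lo_def flip_hi_def gr0_conv_Suc)

text \<open>The lower bound at \<open>i\<close> and the upper bound at \<open>i + 1\<close> are the
  maximum and minimum of the same two numbers, so their sum needs no case distinction and the total
  telescopes up to a boundary term.\<close>

lemma sum_flip_bounds:
  "(\<Sum>i<N. flip_lo r g i + flip_hi r g i) + flip_hi r g N =
    (\<Sum>i<N. g r i) + (\<Sum>i<N. g (Suc (Suc r)) i) + g (Suc (Suc r)) N"
proof (induction N)
  case 0
  then show ?case by (simp add: flip_hi_def)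
next
  case (Suc N)
  have "flip_lo r g N + flip_hi r g (Suc N) = g r N + g (Suc (Suc r)) (Suc N)"
    by (simp add: flip_lo_def flip_hi_def)
  then show ?case using Suc.IH by simp
qed

text \<open>The bounds encode all inequalities between the reflected row and its two neighbours. By
  the sum of the bounds, the new row total is that of rows \<open>r\<close> and \<open>r + 2\<close>
  minus the old one, which exchanges the two exponents.\<close>

lemma flip_in_GT:
  assumes g: "g \<in> GT lam m"
    and m': "Poly_Mapping.lookup m' = (Poly_Mapping.lookup m)
      (r := Poly_Mapping.lookup m (Suc r), Suc r := Poly_Mapping.lookup m r)"
  shows "flip r g \<in> GT lam m'"
proof -
  let ?h = "flip r g" and ?L = "length lam"
  have h: "?h (Suc r) i = flip_lo r g i + flip_hi r g i - g (Suc r) i"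
    and h_other: "k \<noteq> Suc r \<Longrightarrow> ?h k = g k" for i k
    by (auto simp: flip_def)
  have lo: "flip_lo r g i \<le> ?h (Suc r) i" and hi: "?h (Suc r) i \<le> flip_hi r g i" for i
    using flip_bounds[OF g, of r i] by (auto simp: h)
  have lo': "g r i \<le> flip_lo r g i" "g (Suc (Suc r)) (Suc i) \<le> flip_lo r g i"
    and hi': "flip_hi r g i \<le> g (Suc (Suc r)) i" "flip_hi r g (Suc i) \<le> g r i" for i
    by (auto simp: flip_lo_def flip_hi_def)
  have G: "g 0 i = 0" "g k i \<le> g (Suc k) i" "g (Suc k) (Suc i) \<le> g k i"
    "(\<Sum>i<?L. g (Suc k) i) = (\<Sum>i<?L. g k i) + Poly_Mapping.lookup m k" for k i
    using g by (auto simp: GT_def)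
  obtain K where K: "\<forall>k\<ge>K. \<forall>i. g k i = row lam i" using g by (auto simp: GT_def)
  have "?h 0 i = 0" for i by (simp add: h_other G)
  moreover have "?h k i \<le> ?h (Suc k) i" for k i
  proof -
    consider "k = r" | "k = Suc r" | "k \<noteq> r" "k \<noteq> Suc r" by blast
    then show ?thesis
    proof cases
      case 1 then show ?thesis using lo[of i] lo'(1)[of i] by (simp add: h_other)
    next
      case 2 then show ?thesis using hi[of i] hi'(1)[of i] by (simp add: h_other)
    next
      case 3 then show ?thesis using G by (simp add: h_other)
    qed
  qed
  moreover have "?h (Suc k) (Suc i) \<le> ?h k i" for k i
  proof -
    consider "k = r" | "k = Suc r" | "k \<noteq> r" "k \<noteq> Suc r" by blast
    then show ?thesis
    proof cases
      case 1 then show ?thesis using hi[of "Suc i"] hi'(2)[of i] by (simp add: h_other)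
    next
      case 2 then show ?thesis using lo[of i] lo'(2)[of i] by (simp add: h_other)
    next
      case 3 then show ?thesis using G by (simp add: h_other)
    qed
  qed
  moreover have "\<forall>k\<ge>max K (Suc (Suc r)). \<forall>i. ?h k i = row lam i"
    using K by (simp add: h_other)
  moreover have "(\<Sum>i<?L. ?h (Suc k) i) = (\<Sum>i<?L. ?h k i) + Poly_Mapping.lookup m' k" for k
  proof -
    have "g (Suc (Suc r)) ?L = 0" using GT_mono(3)[OF g, of "Suc (Suc r)" ?L] by (simp add: row_def)
    then have "(\<Sum>i<?L. flip_lo r g i + flip_hi r g i) = (\<Sum>i<?L. g r i) + (\<Sum>i<?L. g (Suc (Suc r)) i)"
      using sum_flip_bounds[where r = r and g = g and N = ?L] hi'(1)[of ?L] by simp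
    moreover have "(\<Sum>i<?L. ?h (Suc r) i) + (\<Sum>i<?L. g (Suc r) i) =
        (\<Sum>i<?L. flip_lo r g i + flip_hi r g i)"
      unfolding sum.distrib[symmetric] using flip_bounds[OF g, of r] by (intro sum.cong) (simp_all add: h add_increasing)
    ultimately have mid: "(\<Sum>i<?L. ?h (Suc r) i) = (\<Sum>i<?L. g r i) + Poly_Mapping.lookup m (Suc r)"
      using G(4)[of r] G(4)[of "Suc r"] by simp
    consider "k = r" | "k = Suc r" | "k \<noteq> r" "k \<noteq> Suc r" by blast
    then show ?thesis
    proof cases
      case 1 then show ?thesis using mid by (simp add: h_other m')
    next
      case 2 then show ?thesis using mid G(4)[of r] G(4)[of "Suc r"] by (simp add: h_other m')
    next
      case 3 then show ?thesis using G(4)[of k] by (simp add: h_other m')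
    qed
  qed
  ultimately show ?thesis unfolding GT_def by blast
qed

text \<open>The bounds depend only on rows \<open>r\<close> and \<open>r + 2\<close>, which
  \<open>flip\<close> leaves alone, so the second reflection takes place in the same
  intervals.\<close>

lemma flip_flip:
  assumes "g \<in> GT lam m"
  shows "flip r (flip r g) = g"
proof -
  have "flip_lo r (flip r g) = flip_lo r g" "flip_hi r (flip r g) = flip_hi r g"
    by (auto simp: fun_eq_iff flip_lo_def flip_hi_def flip_def)
  note eqs = this
  have mid: "flip r h (Suc r) i = flip_lo r h i + flip_hi r h i - h (Suc r) i" for h i
    by (simp add: flip_def)
  show ?thesis
  proof (intro ext)
    fix k i
    show "flip r (flip r g) k i = g k i"
    proof (cases "k = Suc r")
      case True
      then show ?thesis using flip_bounds[OF assms, of r i] by (simp add: mid eqs)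
    qed (simp add: flip_def)
  qed
qed

lemma adj_sym_schur:
  assumes lam: "is_partition_of lam n"
  shows "adj_sym (schur lam)"
  unfolding adj_sym_def
proof (intro allI impI)
  fix r and m m' :: "nat \<Rightarrow>\<^sub>0 nat"
  assume m': "Poly_Mapping.lookup m' = (Poly_Mapping.lookup m)
      (r := Poly_Mapping.lookup m (Suc r), Suc r := Poly_Mapping.lookup m r)"
  then have m: "Poly_Mapping.lookup m = (Poly_Mapping.lookup m')
      (r := Poly_Mapping.lookup m' (Suc r), Suc r := Poly_Mapping.lookup m' r)"
    by auto
  have "bij_betw (flip r) (GT lam m) (GT lam m')"
    by (rule bij_betw_byWitness[where f' = "flip r"])
       (use flip_flip flip_in_GT[OF _ m'] flip_in_GT[OF _ m] in blast)+
  then have "card (SSYT_content lam m) = card (SSYT_content lam m')"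
    using bij_betw_pattern_of[OF lam] by (metis bij_betw_same_card)
  then show "mfps_coeff (schur lam) m' = mfps_coeff (schur lam) m"
    by (simp add: schur_def SSYT_content_def)
qed

lemma schur_homogeneous:
  assumes lam: "is_partition_of lam n" and nz: "mfps_coeff (schur lam) m \<noteq> 0"
  shows "mdeg m = n"
proof -
  have "card (SSYT_content lam m) \<noteq> 0"
    using nz by (simp add: schur_def SSYT_content_def)
  then have "SSYT_content lam m \<noteq> {}" by auto
  then obtain T where T: "\<And>k. card {c \<in> cells lam. T c = k} = Poly_Mapping.lookup m k"
    by (auto simp: SSYT_content_def)
  have "T ` cells lam \<subseteq> Poly_Mapping.keys m"
  proof
    fix k assume "k \<in> T ` cells lam"
    then have "{c \<in> cells lam. T c = k} \<noteq> {}" by blast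
    moreover have "finite {c \<in> cells lam. T c = k}" by simp
    ultimately have "card {c \<in> cells lam. T c = k} \<noteq> 0" by (metis card_0_eq)
    then show "k \<in> Poly_Mapping.keys m" by (simp add: T in_keys_iff)
  qed
  then have "(\<Sum>k\<in>Poly_Mapping.keys m. \<Sum>c | c \<in> cells lam \<and> T c = k. 1) =
      (\<Sum>c\<in>cells lam. 1 :: nat)"
    by (intro sum.group) auto
  then show ?thesis
    using lam by (simp add: wt_def T card_cells is_partition_of_def)
qed

section \<open>Standardization\<close>

definition srank :: "nat set \<Rightarrow> nat \<Rightarrow> nat" where
  "srank S j = card {s \<in> S. s < j}"

lemma srank_mono: "finite S \<Longrightarrow> i \<le> j \<Longrightarrow> srank S i \<le> srank S j"
  unfolding srank_def by (rule card_mono) auto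

lemma srank_less:
  assumes "finite S" "s \<in> S" "i \<le> s" "s < j"
  shows "srank S i < srank S j"
  unfolding srank_def
proof (rule psubset_card_mono)
  have "{t \<in> S. t < i} \<subseteq> {t \<in> S. t < j}" using assms(3,4) by auto
  moreover have "s \<in> {t \<in> S. t < j}" "s \<notin> {t \<in> S. t < i}" using assms by auto
  ultimately show "{t \<in> S. t < i} \<subset> {t \<in> S. t < j}" by blast
qed (use assms(1) in simp)

lemma srank_Suc: "v \<notin> S \<Longrightarrow> srank S (Suc v) = srank S v"
  unfolding srank_def by (rule arg_cong[of _ _ card]) (auto simp: less_Suc_eq)

lemma lookup_comp_monom:
  "Poly_Mapping.lookup (comp_monom n S) k = card {j \<in> {1..n}. srank S j = k}"
  unfolding comp_monom_def srank_def by (subst lookup_sum_single) auto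

text \<open>The position of a cell when all cells are ordered by entry and equal entries from left
  to right; in a semistandard tableau equal entries never share a column.\<close>

definition standardize :: "nat list \<Rightarrow> (nat \<times> nat \<Rightarrow> nat) \<Rightarrow> nat \<times> nat \<Rightarrow> nat" where
  "standardize lam U = restrict (\<lambda>c. card {c' \<in> cells lam.
     U c' < U c \<or> U c' = U c \<and> snd c' \<le> snd c}) (cells lam)"

definition destandardize :: "nat list \<Rightarrow> nat set \<Rightarrow> (nat \<times> nat \<Rightarrow> nat) \<Rightarrow> nat \<times> nat \<Rightarrow> nat" where
  "destandardize lam S T = restrict (\<lambda>c. srank S (T c)) (cells lam)"

context
  fixes lam :: "nat list" and n :: nat and S :: "nat set"
  assumes lam: "is_partition_of lam n" and S: "S \<subseteq> {1..<n}"
begin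

lemma finite_S: "finite S" using S finite_subset by blast

lemma sum_lam: "sum_list lam = n" using lam by (simp add: is_partition_of_def)

lemma cells_corner: "(i', j') \<in> cells lam \<Longrightarrow> i \<le> i' \<Longrightarrow> j \<le> j' \<Longrightarrow> (i, j) \<in> cells lam"
  using row_antimono[OF lam, of i i'] by simp

section \<open>From standard to semistandard tableaux\<close>

context
  fixes T :: "nat \<times> nat \<Rightarrow> nat"
  assumes T: "T \<in> SYT lam"
begin

lemma SYT_bij: "bij_betw T (cells lam) {1..n}"
  using T sum_lam by (simp add: SYT_def)

lemma SYT_mono:
  assumes "(i', j') \<in> cells lam" "i \<le> i'" "j \<le> j'"
  shows "T (i, j) \<le> T (i', j')"
proof -
  have "(i, j') \<in> cells lam" using cells_corner[OF assms(1,2)] by simp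
  then have "T (i, j) \<le> T (i, j')" using T assms(3) by (cases "j = j'") (auto simp: SYT_def less_imp_le)
  also have "\<dots> \<le> T (i', j')" using T assms by (cases "i = i'") (auto simp: SYT_def less_imp_le)
  finally show ?thesis .
qed

text \<open>Were the second cell weakly left of the first in addition to being weakly above it, its
  entry could not be the larger one.\<close>

lemma no_descent_step:
  assumes "c \<in> cells lam" "c' \<in> cells lam" "T c' = Suc (T c)" "T c \<notin> descent_set lam T"
  shows "fst c' \<le> fst c \<and> snd c < snd c'"
proof -
  obtain i j i' j' where c: "c = (i, j)" "c' = (i', j')" by (cases c, cases c')
  have "\<not> i < i'" using assms unfolding c descent_set_def by auto
  moreover have "j < j'"
  proof (rule ccontr)
    assume "\<not> j < j'"
    then have "T (i', j') \<le> T (i, j)"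
      using SYT_mono[of i j i' j'] assms(1) \<open>\<not> i < i'\<close> unfolding c by simp
    then show False using assms(3) unfolding c by simp
  qed
  ultimately show ?thesis by (simp add: c)
qed

text \<open>A run of consecutive entries without descents moves weakly up and strictly right at
  every step. All intermediate entries occur because \<open>T\<close> is onto.\<close>

lemma no_descent_chain:
  assumes c: "c \<in> cells lam" and c': "c' \<in> cells lam" and lt: "T c < T c'"
    and nd: "\<And>v. T c \<le> v \<Longrightarrow> v < T c' \<Longrightarrow> v \<notin> descent_set lam T"
  shows "fst c' \<le> fst c \<and> snd c < snd c'"
proof -
  have "\<forall>c'\<in>cells lam. T c' = Suc v \<longrightarrow> fst c' \<le> fst c \<and> snd c < snd c'"
    if "T c \<le> v" "v < T c'" for v
    using that
  proof (induction v rule: dec_induct)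
    case base
    then show ?case using no_descent_step[OF c] nd[of "T c"] lt by auto
  next
    case (step v)
    show ?case
    proof (intro ballI impI)
      fix d assume d: "d \<in> cells lam" "T d = Suc (Suc v)"
      have "Suc v \<in> {1..n}"
        using bij_betw_apply[OF SYT_bij d(1)] d(2) by simp
      then obtain e where e: "e \<in> cells lam" "T e = Suc v"
        using SYT_bij unfolding bij_betw_def by (metis imageE)
      have 1: "fst e \<le> fst c \<and> snd c < snd e" using step e by simp
      have "T e \<notin> descent_set lam T" unfolding e(2) by (rule nd) (use step in auto)
      then have "fst d \<le> fst e \<and> snd e < snd d"
        by (intro no_descent_step) (use d e in auto)
      then show "fst d \<le> fst c \<and> snd c < snd d" using 1 by simp
    qed
  qed
  from this[of "T c' - 1"] show ?thesis using lt c' by simp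
qed

lemma card_T_le:
  assumes "c \<in> cells lam"
  shows "card {c' \<in> cells lam. T c' \<le> T c} = T c"
proof -
  have "T c \<le> n" using bij_betw_apply[OF SYT_bij assms] by simp
  have "bij_betw T {c' \<in> cells lam. T c' \<le> T c} {1..T c}"
    unfolding bij_betw_def
  proof
    show "inj_on T {c' \<in> cells lam. T c' \<le> T c}"
      using SYT_bij by (auto simp: bij_betw_def intro: inj_on_subset)
    have "v \<in> T ` {c' \<in> cells lam. T c' \<le> T c}" if "v \<in> {1..T c}" for v
    proof -
      have "v \<in> T ` cells lam" using that \<open>T c \<le> n\<close> SYT_bij by (simp add: bij_betw_def)
      then show ?thesis using that by auto
    qed
    moreover have "T c' \<ge> 1" if "c' \<in> cells lam" for c'
      using bij_betw_apply[OF SYT_bij that] by simp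
    ultimately show "T ` {c' \<in> cells lam. T c' \<le> T c} = {1..T c}" by auto
  qed
  then show ?thesis using bij_betw_same_card by fastforce
qed

text \<open>Two entries of the same column must be separated by a descent, which lies in
  \<open>S\<close>; hence their block indices differ and columns become strict.\<close>

lemma destandardize_in_SSYT_content:
  assumes D: "descent_set lam T \<subseteq> S"
  shows "destandardize lam S T \<in> SSYT_content lam (comp_monom n S)"
proof -
  let ?U = "destandardize lam S T"
  have U: "?U c = srank S (T c)" if "c \<in> cells lam" for c
    using that by (simp add: destandardize_def)
  have "?U (i, j) \<le> ?U (i, j')" if "j < j'" "(i, j') \<in> cells lam" for i j j'
  proof -
    have "(i, j) \<in> cells lam" using cells_corner[OF that(2), of i j] that(1) by simp
    then show ?thesis using SYT_mono[OF that(2), of i j] that srank_mono[OF finite_S] by (simp only: U)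
  qed
  moreover have "?U (i, j) < ?U (i', j)" if "i < i'" "(i', j) \<in> cells lam" for i i' j
  proof -
    have c: "(i, j) \<in> cells lam" using cells_corner[OF that(2), of i j] that(1) by simp
    have lt: "T (i, j) < T (i', j)" using T that by (auto simp: SYT_def)
    have "\<exists>v. T (i, j) \<le> v \<and> v < T (i', j) \<and> v \<in> descent_set lam T"
      using no_descent_chain[OF c that(2) lt] that(1) by fastforce
    then obtain v where "T (i, j) \<le> v" "v < T (i', j)" "v \<in> S" using D by blast
    then show ?thesis using srank_less[OF finite_S, of v] c that(2) by (simp only: U)
  qed
  moreover have "card {c \<in> cells lam. ?U c = k} = Poly_Mapping.lookup (comp_monom n S) k" for k
  proof -
    have "bij_betw T {c \<in> cells lam. ?U c = k} {j \<in> {1..n}. srank S j = k}"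
      unfolding bij_betw_def
    proof
      show "inj_on T {c \<in> cells lam. ?U c = k}"
        using SYT_bij by (auto simp: bij_betw_def intro: inj_on_subset)
      have "{1..n} = T ` cells lam" using SYT_bij by (simp add: bij_betw_def)
      then show "T ` {c \<in> cells lam. ?U c = k} = {j \<in> {1..n}. srank S j = k}"
        using U by auto
    qed
    then show ?thesis by (simp add: lookup_comp_monom bij_betw_same_card)
  qed
  ultimately show ?thesis
    by (auto simp: SSYT_content_def SSYT_def destandardize_def simp del: mem_cells)
qed

text \<open>Entries in the same block form a run without descents, so their order agrees with the
  order of columns, which is how \<open>standardize\<close> breaks ties.\<close>

lemma standardize_destandardize:
  assumes D: "descent_set lam T \<subseteq> S"
  shows "standardize lam (destandardize lam S T) = T"
proof
  fix c
  let ?U = "destandardize lam S T"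
  have U: "?U c = srank S (T c)" if "c \<in> cells lam" for c
    using that by (simp add: destandardize_def)
  have less: "?U c < ?U c' \<or> ?U c = ?U c' \<and> snd c < snd c'"
    if c: "c \<in> cells lam" and c': "c' \<in> cells lam" and lt: "T c < T c'" for c c'
  proof (cases "?U c = ?U c'")
    case False
    then show ?thesis using srank_mono[OF finite_S, of "T c" "T c'"] lt U c c' by simp
  next
    case True
    have "v \<notin> descent_set lam T" if "T c \<le> v" "v < T c'" for v
      using srank_less[OF finite_S _ that] True U[OF c] U[OF c'] D by auto
    then show ?thesis using no_descent_chain[OF c c' lt] True by blast
  qed
  show "standardize lam ?U c = T c"
  proof (cases "c \<in> cells lam")
    case True
    have iff: "(?U c' < ?U c \<or> ?U c' = ?U c \<and> snd c' \<le> snd c) \<longleftrightarrow> T c' \<le> T c"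
      if c': "c' \<in> cells lam" for c'
    proof (cases "T c' = T c")
      case eq: True
      then have "c' = c" using SYT_bij True c' by (auto simp: bij_betw_def dest: inj_onD)
      then show ?thesis by simp
    next
      case False
      then show ?thesis using less[OF c' True] less[OF True c'] by (cases "T c' < T c") auto
    qed
    have "{c' \<in> cells lam. ?U c' < ?U c \<or> ?U c' = ?U c \<and> snd c' \<le> snd c} =
        {c' \<in> cells lam. T c' \<le> T c}"
      by (rule Collect_cong) (use iff in blast)
    then have "standardize lam ?U c = card {c' \<in> cells lam. T c' \<le> T c}"
      using True by (simp add: standardize_def)
    then show ?thesis using card_T_le[OF True] by simp
  next
    case False
    have "T \<in> extensional (cells lam)" using T by (simp add: SYT_def)
    from extensional_arb[OF this False] show ?thesis using False by (simp add: standardize_def)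
  qed
qed

end

section \<open>From semistandard back to standard tableaux\<close>

context
  fixes U :: "nat \<times> nat \<Rightarrow> nat"
  assumes U: "U \<in> SSYT_content lam (comp_monom n S)"
begin

lemma U_SSYT: "U \<in> SSYT lam"
  using U unfolding SSYT_content_def by blast

lemma U_row:
  assumes "j \<le> j'" "(i, j') \<in> cells lam"
  shows "U (i, j) \<le> U (i, j')"
proof (cases "j = j'")
  case False
  then have "j < j'" using assms(1) by simp
  then show ?thesis using U_SSYT assms(2) unfolding SSYT_def by blast
qed simp

lemma U_col: "i < i' \<Longrightarrow> (i', j) \<in> cells lam \<Longrightarrow> U (i, j) < U (i', j)"
  using U_SSYT unfolding SSYT_def by blast

lemma U_inj:
  assumes "c \<in> cells lam" "c' \<in> cells lam" "U c = U c'" "snd c = snd c'"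
  shows "c = c'"
proof -
  obtain i j i' where c: "c = (i, j)" "c' = (i', j)" using assms(4) by (cases c, cases c') auto
  show ?thesis
    using U_col[of i i' j] U_col[of i' i j] assms unfolding c by (cases i i' rule: linorder_cases) auto
qed

abbreviation le_pos :: "nat \<times> nat \<Rightarrow> nat \<times> nat \<Rightarrow> bool" where
  "le_pos c' c \<equiv> U c' < U c \<or> U c' = U c \<and> snd c' \<le> snd c"

lemma standardize_eq: "c \<in> cells lam \<Longrightarrow> standardize lam U c = card {c' \<in> cells lam. le_pos c' c}"
  by (simp add: standardize_def)

lemma standardize_less:
  assumes "c \<in> cells lam" "c' \<in> cells lam" "le_pos c c'" "c \<noteq> c'"
  shows "standardize lam U c < standardize lam U c'"
  unfolding standardize_eq[OF assms(1)] standardize_eq[OF assms(2)]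
proof (rule psubset_card_mono)
  have "\<not> le_pos c' c"
  proof
    assume "le_pos c' c"
    then have "U c = U c'" "snd c = snd c'" using assms(3) by linarith+
    then show False using U_inj[OF assms(1,2)] assms(4) by blast
  qed
  then show "{d \<in> cells lam. le_pos d c} \<subset> {d \<in> cells lam. le_pos d c'}"
    using assms(2,3) by (auto simp del: mem_cells)
qed simp

lemma standardize_bij: "bij_betw (standardize lam U) (cells lam) {1..n}"
proof -
  let ?T = "standardize lam U"
  have inj: "inj_on ?T (cells lam)"
  proof (rule inj_onI, rule ccontr)
    fix c c' assume c: "c \<in> cells lam" "c' \<in> cells lam" "?T c = ?T c'" "c \<noteq> c'"
    have "le_pos c c' \<or> le_pos c' c" by auto
    then show False using standardize_less[of c c'] standardize_less[of c' c] c by auto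
  qed
  have "?T ` cells lam \<subseteq> {1..n}"
  proof
    fix v assume "v \<in> ?T ` cells lam"
    then obtain c where c: "c \<in> cells lam" "v = card {c' \<in> cells lam. le_pos c' c}"
      using standardize_eq by blast
    have "card {c} \<le> v" unfolding c(2) by (rule card_mono) (use c in auto)
    moreover have "v \<le> card (cells lam)" unfolding c(2) by (rule card_mono) auto
    ultimately show "v \<in> {1..n}" by (simp add: card_cells sum_lam)
  qed
  moreover have "card (?T ` cells lam) = card {1..n}"
    using card_image[OF inj] by (simp add: card_cells sum_lam)
  ultimately have "?T ` cells lam = {1..n}" by (intro card_subset_eq) auto
  then show ?thesis using inj by (simp add: bij_betw_def)
qed

lemma card_U_less: "card {c \<in> cells lam. U c < k} = card {j \<in> {1..n}. srank S j < k}"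
proof (induction k)
  case (Suc k)
  have "card {x \<in> A. f x < Suc k} = card {x \<in> A. f x < k} + card {x \<in> A. f x = k}"
    if "finite A" for A :: "'x set" and f :: "'x \<Rightarrow> nat"
    using that by (subst card_Un_disjoint[symmetric]) (auto intro!: arg_cong[of _ _ card])
  from this[of "cells lam" U] this[of "{1..n}" "srank S"] Suc U show ?case
    by (simp add: SSYT_content_def lookup_comp_monom)
qed simp

text \<open>For each \<open>k\<close>, the positions in blocks below \<open>k\<close> are as many as
  the cells with entries below \<open>k\<close>, and both come first in their orders. So both
  inequalities with \<open>k\<close> say that the position of \<open>c\<close> does not exceed this
  common number.\<close>

lemma srank_standardize:
  assumes c: "c \<in> cells lam"
  shows "srank S (standardize lam U c) = U c"
proof -
  let ?t = "standardize lam U c"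
  have t: "?t \<in> {1..n}" using bij_betw_apply[OF standardize_bij c] .
  have "srank S ?t < k \<longleftrightarrow> U c < k" for k
  proof -
    have "srank S ?t < k \<longleftrightarrow> ?t \<le> card {j \<in> {1..n}. srank S j < k}"
    proof
      assume lt: "srank S ?t < k"
      have "{1..?t} \<subseteq> {j \<in> {1..n}. srank S j < k}"
      proof
        fix x assume x: "x \<in> {1..?t}"
        then have "srank S x < k" using srank_mono[OF finite_S, of x ?t] lt by simp
        then show "x \<in> {j \<in> {1..n}. srank S j < k}" using x t by simp
      qed
      then have "card {1..?t} \<le> card {j \<in> {1..n}. srank S j < k}" by (intro card_mono) auto
      then show "?t \<le> card {j \<in> {1..n}. srank S j < k}" by simp
    next
      assume le: "?t \<le> card {j \<in> {1..n}. srank S j < k}"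
      show "srank S ?t < k"
      proof (rule ccontr)
        assume ge: "\<not> srank S ?t < k"
        have "{j \<in> {1..n}. srank S j < k} \<subseteq> {1..<?t}"
        proof
          fix x assume x: "x \<in> {j \<in> {1..n}. srank S j < k}"
          then have "\<not> ?t \<le> x" using srank_mono[OF finite_S, of ?t x] ge by auto
          then show "x \<in> {1..<?t}" using x by simp
        qed
        then have "card {j \<in> {1..n}. srank S j < k} \<le> card {1..<?t}" by (intro card_mono) auto
        then show False using le t by auto
      qed
    qed
    also have "\<dots> \<longleftrightarrow> ?t \<le> card {c \<in> cells lam. U c < k}" by (simp only: card_U_less)
    also have "\<dots> \<longleftrightarrow> U c < k"
    proof
      assume lt: "U c < k"
      show "?t \<le> card {c \<in> cells lam. U c < k}"
        unfolding standardize_eq[OF c] by (rule card_mono) (use lt in \<open>auto simp del: mem_cells\<close>)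
    next
      assume le: "?t \<le> card {c \<in> cells lam. U c < k}"
      show "U c < k"
      proof (rule ccontr)
        assume "\<not> U c < k"
        then have "{c \<in> cells lam. U c < k} \<subset> {c' \<in> cells lam. le_pos c' c}"
          using c by (auto simp del: mem_cells)
        then have "card {c \<in> cells lam. U c < k} < ?t"
          unfolding standardize_eq[OF c] by (intro psubset_card_mono) auto
        then show False using le by simp
      qed
    qed
    finally show ?thesis .
  qed
  then show ?thesis by (metis linorder_neqE_nat less_irrefl)
qed

lemma standardize_in_SYT: "standardize lam U \<in> SYT lam"
proof -
  let ?T = "standardize lam U"
  have "?T (i, j) < ?T (i, j')" if "j < j'" "(i, j') \<in> cells lam" for i j j'
  proof (rule standardize_less)
    show "(i, j) \<in> cells lam" using cells_corner[OF that(2), of i j] that(1) by simp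
    show "le_pos (i, j) (i, j')" using U_row[of j j' i] that by auto
  qed (use that in auto)
  moreover have "?T (i, j) < ?T (i', j)" if "i < i'" "(i', j) \<in> cells lam" for i i' j
  proof (rule standardize_less)
    show "(i, j) \<in> cells lam" using cells_corner[OF that(2), of i j] that(1) by simp
    show "le_pos (i, j) (i', j)" using U_col[of i i' j] that by auto
  qed (use that in auto)
  moreover have "?T \<in> extensional (cells lam)" by (simp add: standardize_def)
  ultimately show ?thesis
    using standardize_bij by (simp add: SYT_def sum_lam del: mem_cells)
qed

text \<open>If \<open>v\<close> is not in \<open>S\<close>, then \<open>v\<close> and
  \<open>v + 1\<close> lie in one block and their cells have equal entries in \<open>U\<close>. Ties
  run from left to right, so the second cell is further right; were it also lower, row and column
  conditions would make its entry larger.\<close>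

lemma descent_set_standardize: "descent_set lam (standardize lam U) \<subseteq> S"
proof
  let ?T = "standardize lam U"
  fix v assume "v \<in> descent_set lam ?T"
  then obtain i j i' j' where c: "(i, j) \<in> cells lam" "(i', j') \<in> cells lam"
    "?T (i, j) = v" "?T (i', j') = Suc v" "i < i'"
    by (auto simp: descent_set_def simp del: mem_cells)
  show "v \<in> S"
  proof (rule ccontr)
    assume "v \<notin> S"
    then have eq: "U (i, j) = U (i', j')"
      using srank_standardize[OF c(1)] srank_standardize[OF c(2)] c(3,4) srank_Suc[of v S] by simp
    have "j < j'"
    proof (rule ccontr)
      assume "\<not> j < j'"
      then have "?T (i', j') < ?T (i, j)"
        using c eq by (intro standardize_less) auto
      then show False using c by simp
    qed
    moreover have "(i, j') \<in> cells lam" using cells_corner[OF c(2), of i j'] c(5) by simp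
    ultimately have "U (i, j) < U (i', j')"
      using U_row[of j j' i] U_col[OF c(5) c(2)] by simp
    then show False using eq by simp
  qed
qed

lemma destandardize_standardize: "destandardize lam S (standardize lam U) = U"
proof
  fix c
  show "destandardize lam S (standardize lam U) c = U c"
  proof (cases "c \<in> cells lam")
    case True
    then show ?thesis using srank_standardize by (simp add: destandardize_def)
  next
    case False
    have "U \<in> extensional (cells lam)" using U by (simp add: SSYT_content_def SSYT_def)
    from extensional_arb[OF this False] show ?thesis using False by (simp add: destandardize_def)
  qed
qed

end

lemma card_descents_subset:
  "of_nat (card {T \<in> SYT lam. descent_set lam T \<subseteq> S}) = mfps_coeff (schur lam) (comp_monom n S)"
proof -
  have "bij_betw (destandardize lam S) {T \<in> SYT lam. descent_set lam T \<subseteq> S}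
      (SSYT_content lam (comp_monom n S))"
    by (rule bij_betw_byWitness[where f' = "standardize lam"])
       (use standardize_destandardize destandardize_standardize destandardize_in_SSYT_content
          standardize_in_SYT descent_set_standardize in blast)+
  then show ?thesis by (simp add: schur_def SSYT_content_def bij_betw_same_card)
qed

end

section \<open>Inclusion-exclusion over descent sets\<close>

lemma finite_SYT: "finite (SYT lam)"
proof (rule finite_subset)
  show "SYT lam \<subseteq> cells lam \<rightarrow>\<^sub>E {1..sum_list lam}"
    by (auto simp: SYT_def PiE_def bij_betw_def simp del: mem_cells)
  show "finite (cells lam \<rightarrow>\<^sub>E {1..sum_list lam})" by (intro finite_PiE) auto
qed

text \<open>Complements in \<open>A\<close> turn this into the alternating sum over subsets of
  \<open>A - D\<close>. If \<open>D\<close> is not contained in \<open>A\<close>, the sum is empty,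
  so tableaux with other descents drop out.\<close>

lemma sum_supersets_minus_one_power:
  assumes "finite A"
  shows "(\<Sum>S | S \<subseteq> A \<and> D \<subseteq> S. (-1) ^ card (A - S)) = (if D = A then 1 else 0 :: rat)"
proof (cases "D \<subseteq> A")
  case True
  have "(\<Sum>S | S \<subseteq> A \<and> D \<subseteq> S. (-1) ^ card (A - S)) = (\<Sum>X\<in>Pow (A - D). (-1) ^ card X :: rat)"
    by (rule sum.reindex_bij_witness[of _ "\<lambda>X. A - X" "\<lambda>S. A - S"]) (use True in auto)
  also have "\<dots> = (if A - D = {} then 1 else 0)"
    using assms by (intro sum_Pow_minus_one_power) simp
  finally show ?thesis using True by auto
next
  case False
  then have none: "{S. S \<subseteq> A \<and> D \<subseteq> S} = {}" and "D \<noteq> A" by auto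
  then show ?thesis unfolding none by simp
qed

lemma card_descents_eq_alt_functional:
  assumes lam: "is_partition_of lam n"
  shows "of_nat (card {T \<in> SYT lam. descent_set lam T = parity_set c n}) =
    alt_functional c n (schur lam)"
proof -
  let ?A = "parity_set c n" and ?D = "descent_set lam"
  have "alt_functional c n (schur lam) =
      (\<Sum>S\<in>Pow ?A. (-1) ^ card (?A - S) * of_nat (card {T \<in> SYT lam. ?D T \<subseteq> S}))"
    unfolding alt_functional_def
  proof (rule sum.cong[OF refl])
    fix S assume "S \<in> Pow ?A"
    then have "S \<subseteq> {1..<n}" by (auto simp: parity_set_def)
    then show "(-1) ^ card (?A - S) * mfps_coeff (schur lam) (comp_monom n S) =
        (-1) ^ card (?A - S) * of_nat (card {T \<in> SYT lam. ?D T \<subseteq> S})"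
      using card_descents_subset[OF lam] by simp
  qed
  also have "\<dots> = (\<Sum>S\<in>Pow ?A. \<Sum>T\<in>SYT lam. if ?D T \<subseteq> S then (-1) ^ card (?A - S) else 0)"
  proof (rule sum.cong[OF refl])
    fix S
    have "(\<Sum>T\<in>SYT lam. if ?D T \<subseteq> S then (-1) ^ card (?A - S) else 0 :: rat) =
        (\<Sum>T\<in>{T \<in> SYT lam. ?D T \<subseteq> S}. (-1) ^ card (?A - S))"
      by (rule sum.inter_filter[symmetric, OF finite_SYT])
    then show "(-1) ^ card (?A - S) * of_nat (card {T \<in> SYT lam. ?D T \<subseteq> S}) =
        (\<Sum>T\<in>SYT lam. if ?D T \<subseteq> S then (-1) ^ card (?A - S) else 0 :: rat)"
      by (simp add: mult.commute)
  qed
  also have "\<dots> = (\<Sum>T\<in>SYT lam. \<Sum>S\<in>Pow ?A. if ?D T \<subseteq> S then (-1) ^ card (?A - S) else 0)"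
    by (rule sum.swap)
  also have "\<dots> = (\<Sum>T\<in>SYT lam. \<Sum>S | S \<subseteq> ?A \<and> ?D T \<subseteq> S. (-1) ^ card (?A - S))"
    by (rule sum.cong[OF refl]) (simp add: sum.inter_filter[symmetric])
  also have "\<dots> = (\<Sum>T\<in>SYT lam. if ?D T = ?A then 1 else 0)"
    by (simp only: sum_supersets_minus_one_power[OF finite_parity_set])
  also have "\<dots> = of_nat (card {T \<in> SYT lam. ?D T = ?A})"
    by (simp add: sum.inter_filter[OF finite_SYT, symmetric])
  finally show ?thesis ..
qed

theorem theorem4p2:
  fixes lam :: "nat list" and n :: nat
  assumes "is_partition_of lam n"
  shows "(odd n \<longrightarrow>
            alt lam = ralt lam \<and>
            of_nat (ralt lam) = umbral (sym_subst (schur lam) subst_odd)) \<and>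
         (even n \<longrightarrow>
            of_nat (alt lam) = umbral (sym_subst (schur lam) subst_even_alt) \<and>
            of_nat (ralt lam) = umbral (sym_subst (schur lam) subst_even_ralt))"
proof -
  have n: "sum_list lam = n" using assms by (simp add: is_partition_of_def)
  have alt: "of_nat (alt lam) = alt_functional False n (schur lam)"
    using card_descents_eq_alt_functional[OF assms, of False] by (simp add: alt_def n parity_set_def)
  have ralt: "of_nat (ralt lam) = alt_functional True n (schur lam)"
    using card_descents_eq_alt_functional[OF assms, of True] by (simp add: ralt_def n parity_set_def)
  note umbral = umbral_sym_subst[OF adj_sym_schur[OF assms] schur_homogeneous[OF assms]]
  show ?thesis
  proof (intro conjI impI)
    assume odd: "odd n"
    \<comment> \<open>For odd \<open>n\<close> the parity \<open>c\<close> is free in the umbral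
      formula, so both counts equal the same value.\<close>
    have "(of_nat (alt lam) :: rat) = of_nat (ralt lam)"
      unfolding alt ralt using umbral(1)[OF _ odd, of False] umbral(1)[OF _ odd, of True] by simp
    then show "alt lam = ralt lam" by (simp only: of_nat_eq_iff)
    show "of_nat (ralt lam) = umbral (sym_subst (schur lam) subst_odd)"
      unfolding ralt using umbral(1)[OF _ odd, of True] by simp
  next
    assume even: "even n"
    show "of_nat (alt lam) = umbral (sym_subst (schur lam) subst_even_alt)"
      unfolding alt using umbral(2)[OF _ even] by simp
    show "of_nat (ralt lam) = umbral (sym_subst (schur lam) subst_even_ralt)"
      unfolding ralt using umbral(3)[OF _ even] by simp
  qed
qed

end
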